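(* The online scheduler $\mathsf{H}$ described below is a $\varphi$-competitive Eventually-committing scheduler for the One-Fast-Many-Slow problem, where $\varphi=\frac{1+\sqrt5}{2}$. That is, for every Task Arrival Process $\mathcal{T}$, the completion time of the schedule produced by $\mathsf{H}$ on $\mathcal{T}$ is at most $\varphi\,\mathsf{C}^{\infty}$, where $\mathsf{C}^{\infty}$ is the optimal offline completion time for $\mathcal{T}$. Algorithm $\mathsf{H}$: it keeps a standby set $\mathcal{S}$, initially empty. Each task is added to $\mathcal{S}$ when it arrives. At every time $t$ it evaluates every task $\tau_i=(f_i,s_i,t_i)\in\mathcal{S}$ as follows. (1) If $s_i+t\le \varphi\,\mathsf{C}^t$, start $\tau_i$ on an unused slow machine and remove it from $\mathcal{S}$. (2) Otherwise, if simultaneously (a) the fast machine is free or has just finished a task, (b) $\tau_i$ has the largest value of $s_i+t_i$ among all tasks in $\mathcal{S}$, and (c) $t\ge f_i/\varphi$, then start $\tau_i$ on the fast machine and remove it from $\mathcal{S}$. Ties in (b) are broken arbitrarily among the tied tasks satisfying (c).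
   Context: One-Fast-Many-Slow (OFMS) problem. A task is a triple $\tau_i=(f_i,s_i,t_i)$ with $s_i\ge f_i>0$ and $t_i\ge 0$: it needs running time $f_i$ on the fast machine or $s_i$ on a slow machine, and it arrives (is revealed) at time $t_i$. A Task Arrival Process (TAP) is a finite set of tasks $\mathcal{T}=\{\tau_1,\dots,\tau_n\}$ with $t_1\le\dots\le t_n$. There is one fast machine and infinitely many slow machines; each machine runs at most one task at a time and a task cannot start before it arrives. The completion time of a schedule is the earliest time at which all tasks have finished. An online scheduler learns $\tau_i$ only at time $t_i$. In the Eventually-committing model a scheduler may keep an arrived task unassigned for any amount of time, but once a task starts running on a machine it must run there to completion. For $t\ge 0$, $\mathsf{C}^t$ denotes the optimal offline completion time for the set of tasks with arrival time at most $t$ (computable online at time $t$), and $\mathsf{C}^{\infty}$ the optimal offline completion time for all of $\mathcal{T}$. An online scheduler is $c$-competitive if on every TAP its completion time is at most $c$ times the optimal offline completion time. *)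

theory Defs
  imports Complex_Main
begin

section \<open>Tasks and task arrival processes\<close>

datatype task = Task (fast_time: real) (slow_time: real) (arrival: real)

definition valid_task :: "task \<Rightarrow> bool" where
  "valid_task \<tau> \<longleftrightarrow> 0 < fast_time \<tau> \<and> fast_time \<tau> \<le> slow_time \<tau> \<and> 0 \<le> arrival \<tau>"

definition TAP :: "task list \<Rightarrow> bool" where
  "TAP T \<longleftrightarrow> (\<forall>\<tau>\<in>set T. valid_task \<tau>) \<and> sorted (map arrival T)"

section \<open>Schedules and the offline optimum\<close>

datatype machine = Fast | Slow nat

fun run_time :: "machine \<Rightarrow> task \<Rightarrow> real" where
  "run_time Fast \<tau> = fast_time \<tau>"
| "run_time (Slow k) \<tau> = slow_time \<tau>"

text \<open>
  A schedule sends the index of a task to the machine and the time at which it is started; the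
  value \<^term>\<open>None\<close> means that the task is never started. There is only one entry per task, so a
  task that has been started occupies its machine until it is finished.
\<close>

type_synonym schedule = "nat \<rightharpoonup> machine \<times> real"

definition valid_schedule :: "task list \<Rightarrow> schedule \<Rightarrow> bool" where
  "valid_schedule T \<sigma> \<longleftrightarrow>
     dom \<sigma> = {..<length T} \<and>
     (\<forall>i m b. \<sigma> i = Some (m, b) \<longrightarrow> arrival (T ! i) \<le> b) \<and>
     (\<forall>i j m b b'. i \<noteq> j \<longrightarrow> \<sigma> i = Some (m, b) \<longrightarrow> \<sigma> j = Some (m, b') \<longrightarrow>
        b + run_time m (T ! i) \<le> b' \<or> b' + run_time m (T ! j) \<le> b)"

text \<open>The inserted 0 only matters for the empty process, whose completion time is 0.\<close>

definition completion_time :: "task list \<Rightarrow> schedule \<Rightarrow> real" where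
  "completion_time T \<sigma> =
     Max (insert 0 {b + run_time m (T ! i) | i m b. i < length T \<and> \<sigma> i = Some (m, b)})"

definition opt :: "task list \<Rightarrow> real" where
  "opt T = Inf {completion_time T \<sigma> | \<sigma>. valid_schedule T \<sigma>}"

section \<open>Online schedulers in the eventually-committing model\<close>

text \<open>As the arrival times are sorted, this is a prefix of \<^term>\<open>T\<close>, so indices are preserved.\<close>

definition revealed :: "task list \<Rightarrow> real \<Rightarrow> task list" where
  "revealed T t = filter (\<lambda>\<tau>. arrival \<tau> \<le> t) T"

definition started_before :: "schedule \<Rightarrow> real \<Rightarrow> schedule" where
  "started_before \<sigma> t i =
     (case \<sigma> i of None \<Rightarrow> None | Some (m, b) \<Rightarrow> if b < t then Some (m, b) else None)"

definition started_at :: "schedule \<Rightarrow> real \<Rightarrow> (nat \<rightharpoonup> machine)" where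
  "started_at \<sigma> t i =
     (case \<sigma> i of None \<Rightarrow> None | Some (m, b) \<Rightarrow> if b = t then Some m else None)"

text \<open>
  An online scheduler is a decision rule. At each time \<open>t\<close> it sees only \<open>t\<close>, the tasks revealed so
  far and the tasks it has started strictly before \<open>t\<close>, and it returns the admissible choices
  of the tasks to be started at time \<open>t\<close>, together with their machines. There may be several
  admissible choices, since a scheduler may break ties arbitrarily.
\<close>

type_synonym scheduler = "real \<Rightarrow> task list \<Rightarrow> schedule \<Rightarrow> (nat \<rightharpoonup> machine) set"

definition produces :: "scheduler \<Rightarrow> task list \<Rightarrow> schedule \<Rightarrow> bool" where
  "produces A T \<sigma> \<longleftrightarrow>
     (\<forall>i m b. \<sigma> i = Some (m, b) \<longrightarrow> 0 \<le> b) \<and>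
     (\<forall>t\<ge>0. started_at \<sigma> t \<in> A t (revealed T t) (started_before \<sigma> t))"

definition eventually_committing_scheduler :: "scheduler \<Rightarrow> bool" where
  "eventually_committing_scheduler A \<longleftrightarrow>
     (\<forall>T. TAP T \<longrightarrow> (\<exists>\<sigma>. produces A T \<sigma>) \<and> (\<forall>\<sigma>. produces A T \<sigma> \<longrightarrow> valid_schedule T \<sigma>))"

definition competitive :: "real \<Rightarrow> scheduler \<Rightarrow> bool" where
  "competitive c A \<longleftrightarrow>
     (\<forall>T \<sigma>. TAP T \<longrightarrow> produces A T \<sigma> \<longrightarrow> completion_time T \<sigma> \<le> c * opt T)"

section \<open>The scheduler H\<close>

definition phi :: real ("\<phi>") where
  "\<phi> = (1 + sqrt 5) / 2"

text \<open>
  In the following, \<open>R\<close> is the list of tasks revealed up to time \<open>t\<close>, so that \<^term>\<open>opt R\<close> is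
  the optimum for the tasks with arrival time at most \<open>t\<close>, and \<open>h\<close> records the tasks started
  before \<open>t\<close>.
\<close>

definition standby :: "task list \<Rightarrow> schedule \<Rightarrow> nat set" where
  "standby R h = {i. i < length R \<and> h i = None}"

definition slow_starts :: "real \<Rightarrow> task list \<Rightarrow> schedule \<Rightarrow> nat set" where
  "slow_starts t R h = {i \<in> standby R h. slow_time (R ! i) + t \<le> \<phi> * opt R}"

definition fast_free :: "real \<Rightarrow> task list \<Rightarrow> schedule \<Rightarrow> bool" where
  "fast_free t R h \<longleftrightarrow> (\<forall>i b. h i = Some (Fast, b) \<longrightarrow> b + fast_time (R ! i) \<le> t)"

text \<open>
  The maximum of \<open>s\<^sub>i + t\<^sub>i\<close> is taken over the standby set after the tasks that go to slow machines
  at time \<open>t\<close> have left it. With the maximum over the set before their removal, a task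
  that is blocked only by tasks leaving at time \<open>t\<close> would have no earliest time to start.
\<close>

definition fast_candidates :: "real \<Rightarrow> task list \<Rightarrow> schedule \<Rightarrow> nat set" where
  "fast_candidates t R h =
     (let S = standby R h - slow_starts t R h
      in {i \<in> S. fast_free t R h \<and>
            (\<forall>j\<in>S. slow_time (R ! j) + arrival (R ! j) \<le> slow_time (R ! i) + arrival (R ! i)) \<and>
            fast_time (R ! i) / \<phi> \<le> t})"

definition H :: scheduler where
  "H t R h =
     {d. \<exists>F. (if fast_candidates t R h = {} then F = {} else \<exists>i\<in>fast_candidates t R h. F = {i}) \<and>
           dom d = slow_starts t R h \<union> F \<and>
           (\<forall>i\<in>F. d i = Some Fast) \<and>
           (\<forall>i\<in>slow_starts t R h. \<exists>k. d i = Some (Slow k) \<and> (\<forall>j b. h j \<noteq> Some (Slow k, b))) \<and>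
           (\<forall>i j k. d i = Some (Slow k) \<longrightarrow> d j = Some (Slow k) \<longrightarrow> i = j)}"

end

theory Submission
  imports Defs
begin

text \<open>
  A task that H starts on a slow machine at time \<open>t\<close> ends by \<open>\<phi> C\<^sup>t\<close>, so only the fast machine matters.
  Consider a busy period of it, beginning at \<open>p\<close>, and let \<open>G(t)\<close> be the total fast time of its tasks
  that arrive by time \<open>t\<close>. By induction on the number of its tasks with \<open>s\<^sub>i + t\<^sub>i \<le> C\<^sup>t\<close> one shows
  \<open>p + G(t) \<le> \<phi> C\<^sup>t\<close>. Tasks with \<open>s\<^sub>i + t\<^sub>i > C\<^sup>t\<close> run on the fast machine in every optimal schedule,
  so those arriving after a time \<open>r\<close> have total length at most \<open>C\<^sup>t - r\<close>. A task with \<open>s\<^sub>i + t\<^sub>i \<le> C\<^sup>t\<close>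
  was not slow-started on arrival, so at that time the optimum was still below \<open>C\<^sup>t / \<phi>\<close>, which bounds the
  work present then; by the priority rule, tasks with larger \<open>s\<^sub>i + t\<^sub>i\<close> that start
  after it also arrive after its start. Finally, just before \<open>p\<close> the fast machine waits either because no
  task of the period has arrived, or because of a task of length at least \<open>\<phi> p\<close>.
\<close>

section \<open>The golden ratio\<close>

lemma phi_gt_1: "1 < \<phi>"
proof -
  have "1 < sqrt 5" by (simp add: real_less_rsqrt)
  then show ?thesis by (simp add: phi_def)
qed

lemma phi_square: "\<phi> * \<phi> = \<phi> + 1"
  by (simp add: phi_def field_simps)

lemma phi_pos: "0 < \<phi>"
  using phi_gt_1 by simp

lemma phi_phi_mult: "\<phi> * (\<phi> * x) = \<phi> * x + x"
  by (simp only: mult.assoc[symmetric] phi_square) (simp add: algebra_simps)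

text \<open>Since \<open>1 / \<phi> = \<phi> - 1\<close>, both sides say
  \<open>x \<le> (\<phi> - 1) * y\<close>. In this form the lemma closes most cases below: on top of
  an optimum \<open>y\<close>, an excess \<open>x\<close> is affordable when
  \<open>\<phi> * x \<le> y\<close>.\<close>

lemma phi_mult_le_iff: "\<phi> * x \<le> y \<longleftrightarrow> x + y \<le> \<phi> * y"
proof -
  have "\<phi> * x \<le> y \<longleftrightarrow> \<phi> * (\<phi> * x) \<le> \<phi> * y"
    using phi_pos by simp
  then have "\<phi> * x \<le> y \<longleftrightarrow> \<phi> * x + x \<le> \<phi> * y"
    by (simp add: phi_phi_mult)
  moreover have "x + y \<le> \<phi> * y \<longleftrightarrow> \<phi> * (x + y) \<le> \<phi> * (\<phi> * y)"
    using phi_pos by simp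
  ultimately show ?thesis by (simp add: phi_phi_mult distrib_left)
qed

text \<open>Both sides say \<open>(\<phi> - 1) * y \<le> x\<close>. It is used to compare a time
  \<open>x\<close> with the optimum \<open>y\<close> at that time.\<close>

lemma le_phi_mult_iff: "y \<le> \<phi> * x \<longleftrightarrow> \<phi> * y \<le> x + y"
proof -
  have "\<phi> * y \<le> x + y \<longleftrightarrow> \<phi> * (\<phi> * y) \<le> \<phi> * (x + y)"
    using phi_pos by simp
  then show ?thesis by (simp add: phi_phi_mult distrib_left)
qed

lemma phi_less_2: "\<phi> < 2"
proof -
  have "sqrt 5 < 3" by (rule real_less_lsqrt) auto
  then show ?thesis by (simp add: phi_def)
qed

lemma phi_mult_ge: "0 \<le> x \<Longrightarrow> x \<le> \<phi> * x"
  using phi_gt_1 mult_right_mono[of 1 \<phi> x] by simp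

section \<open>Busy periods of the fast machine\<close>

text \<open>
  \<open>W\<close> is the set of tasks of the busy period that begins at \<open>p\<close>, \<open>b\<close> gives their starting times and
  \<open>C t\<close> is the optimum for the tasks among \<open>N\<close> revealed by time \<open>t\<close>.
\<close>

locale busy_chain =
  fixes N W :: "'i set" and f s a b :: "'i \<Rightarrow> real" and C :: "real \<Rightarrow> real" and p :: real
  assumes finite_N: "finite N" and W_sub: "W \<subseteq> N"
    and f_pos: "\<And>i. i \<in> N \<Longrightarrow> 0 < f i"
    and a_nonneg: "\<And>i. i \<in> N \<Longrightarrow> 0 \<le> a i"
    and C_mono: "\<And>u v. u \<le> v \<Longrightarrow> C u \<le> C v"
    and C_ge: "\<And>i t. i \<in> N \<Longrightarrow> a i \<le> t \<Longrightarrow> a i + f i \<le> C t"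
    and C_step: "\<And>i t. i \<in> N \<Longrightarrow> a i \<le> t \<Longrightarrow> \<exists>j\<in>N. a j \<le> t \<and> C (a j) = C t"
    and pack: "\<And>Y r t. Y \<subseteq> N \<Longrightarrow> (\<And>y. y \<in> Y \<Longrightarrow> r \<le> a y \<and> a y \<le> t \<and> C t < s y + a y) \<Longrightarrow>
                 r \<le> C t \<Longrightarrow> r + sum f Y \<le> C t"
    and arrive: "\<And>x. x \<in> W \<Longrightarrow> a x \<le> b x"
    and wait: "\<And>x u. x \<in> W \<Longrightarrow> a x \<le> u \<Longrightarrow> u \<le> b x \<Longrightarrow> \<phi> * C u < s x + u"
    and ripe: "\<And>x. x \<in> W \<Longrightarrow> f x \<le> \<phi> * b x"
    and priority: "\<And>x y. x \<in> W \<Longrightarrow> y \<in> W \<Longrightarrow> b x < b y \<Longrightarrow> a y \<le> b x \<Longrightarrow> s y + a y \<le> s x + a x"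
    and b_inj: "inj_on b W"
    and chain: "\<And>x. x \<in> W \<Longrightarrow> b x = p + sum f {y\<in>W. b y < b x}"
    and p_nonneg: "0 \<le> p"
    and idle: "(\<forall>x\<in>W. p \<le> a x) \<or>
               (\<exists>m\<in>N. a m < p \<and> \<phi> * p \<le> f m \<and> (\<forall>x\<in>W. a x < p \<longrightarrow> s x + a x \<le> s m + a m))"
begin

section \<open>Sums of fast times along the busy period\<close>

definition load :: "real \<Rightarrow> real" where
  "load t = sum f {x\<in>W. a x \<le> t}"

lemma finite_W: "finite W"
  using W_sub finite_N finite_subset by blast

lemma sum_f_mono: "A \<subseteq> B \<Longrightarrow> B \<subseteq> N \<Longrightarrow> sum f A \<le> sum f B"
  using finite_N finite_subset[of B N] f_pos by (intro sum_mono2) (auto intro!: less_imp_le)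

lemma sum_f_nonneg: "B \<subseteq> N \<Longrightarrow> 0 \<le> sum f B"
  using sum_f_mono[of "{}" B] by simp

lemma sum_f_Un_le: "A \<subseteq> N \<Longrightarrow> B \<subseteq> N \<Longrightarrow> sum f (A \<union> B) \<le> sum f A + sum f B"
proof -
  assume A: "A \<subseteq> N" and B: "B \<subseteq> N"
  have fin: "finite A" "finite (B - A)" using A B finite_N finite_subset by blast+
  have "sum f (A \<union> B) = sum f A + sum f (B - A)"
    using sum.union_disjoint[OF fin, of f] by (simp add: Un_Diff_cancel)
  also have "sum f (B - A) \<le> sum f B"
    using B by (intro sum_f_mono) auto
  finally show ?thesis by simp
qed

lemma p_le_b: "x \<in> W \<Longrightarrow> p \<le> b x"
  using chain[of x] sum_f_nonneg[of "{y\<in>W. b y < b x}"] W_sub by force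

lemma sum_until:
  assumes "k \<in> W"
  shows "p + sum f {y\<in>W. b y \<le> b k} = b k + f k"
proof -
  have "{y\<in>W. b y \<le> b k} = insert k {y\<in>W. b y < b k}"
    using assms b_inj by (auto simp: inj_on_def order_le_less)
  then show ?thesis
    using chain[OF assms] finite_W by simp
qed

text \<open>The first task of the chain that starts at or after \<open>t\<close> begins exactly when
  the work before it ends, and all of that work starts before \<open>t\<close>.\<close>

lemma busy_until:
  assumes "k \<in> W" "t \<le> b k"
  shows "t \<le> p + sum f {y\<in>W. b y < t}"
proof -
  define S where "S = {x\<in>W. t \<le> b x}"
  have "finite S" "S \<noteq> {}"
    using assms finite_W by (auto simp: S_def)
  then have "Min (b ` S) \<in> b ` S" "\<And>y. y \<in> S \<Longrightarrow> Min (b ` S) \<le> b y"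
    by auto
  then obtain x where x: "x \<in> S" and min: "\<And>y. y \<in> S \<Longrightarrow> b x \<le> b y"
    by (metis imageE)
  have "{y\<in>W. b y < b x} = {y\<in>W. b y < t}"
    using x min by (force simp: S_def)
  then show ?thesis
    using chain[of x] x by (simp add: S_def)
qed

text \<open>A task of the chain arriving before \<open>p\<close> waits because of a task \<open>m\<close> that is too long for the
  fast machine at time \<open>p\<close>; this makes the optimum so large that the waiting task is fast in it.\<close>

lemma early_load:
  assumes "u < p" and "0 \<le> C u"
  shows "load u \<le> C u"
proof (cases "\<forall>x\<in>W. p \<le> a x")
  case True
  then have "{x\<in>W. a x \<le> u} = {}"
    using assms by force
  then show ?thesis
    using assms by (simp only: load_def) simp
next
  case False
  with idle obtain m where m: "m \<in> N" "a m < p" "\<phi> * p \<le> f m" by blast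
  have "C u < s x + a x" if x: "x \<in> W" "a x \<le> u" for x
  proof -
    \<comment> \<open>At \<open>v\<close> both tasks have arrived and \<open>x\<close> is still
      waiting. As \<open>m\<close> counts in \<open>C v\<close>, \<open>v\<close> is at most
      \<open>C v / \<phi>\<close>, and then waiting at \<open>v\<close> forces
      \<open>C v < s x\<close>.\<close>
    define v where "v = max u (a m)"
    have v: "u \<le> v" "a m \<le> v" "v < p" using assms m by (auto simp: v_def)
    have "\<phi> * C v < s x + v"
      using wait[OF x(1), of v] x v p_le_b[OF x(1)] by simp
    moreover have "\<phi> * v \<le> C v"
    proof -
      have "\<phi> * v \<le> \<phi> * p" using v phi_pos by simp
      also have "\<dots> \<le> f m" by fact
      also have "\<dots> \<le> C v" using C_ge[OF m(1), of v] v a_nonneg[OF m(1)] by simp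
      finally show ?thesis .
    qed
    then have "v + C v \<le> \<phi> * C v" by (simp add: phi_mult_le_iff)
    moreover have "C u \<le> C v" using v C_mono by simp
    moreover have "0 \<le> a x" using x W_sub a_nonneg by blast
    ultimately show ?thesis by linarith
  qed
  then have "0 + sum f {x\<in>W. a x \<le> u} \<le> C u"
    using W_sub a_nonneg assms by (intro pack) auto
  then show ?thesis by (simp add: load_def)
qed

section \<open>Consequences of waiting, priority and packing for the load\<close>

lemma arrival_bound:
  assumes "x \<in> W" shows "\<phi> * C (a x) < s x + a x"
  using wait[OF assms, of "a x"] arrive[OF assms] by simp

text \<open>The optimum on arrival of \<open>x\<close> is at least \<open>a x + f x\<close>, and
  \<open>\<phi>\<close> times that optimum is below \<open>s x + a x\<close>, because
  \<open>x\<close> was not slow-started on arrival.\<close>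

lemma f_bound:
  assumes "x \<in> W" "s x + a x \<le> c" shows "\<phi> * (f x + a x) < c"
proof -
  have "f x + a x \<le> C (a x)" using C_ge[of x "a x"] assms W_sub by auto
  then have "\<phi> * (f x + a x) \<le> \<phi> * C (a x)" using phi_pos by simp
  then show ?thesis using arrival_bound[OF assms(1)] assms(2) by linarith
qed

lemma late_sum:
  assumes "Y \<subseteq> W" and "\<And>y. y \<in> Y \<Longrightarrow> r \<le> a y \<and> a y \<le> t \<and> C t < s y + a y" and "r \<le> C t"
  shows "sum f Y \<le> C t - r"
  using pack[of Y r t] assms W_sub by force

lemma sum_three_le:
  assumes "{x\<in>W. a x \<le> t} \<subseteq> A \<union> B \<union> D" "A \<subseteq> W" "B \<subseteq> W" "D \<subseteq> W"
  shows "load t \<le> sum f A + sum f B + sum f D"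
proof -
  have "load t \<le> sum f (A \<union> B \<union> D)"
    unfolding load_def using assms W_sub by (intro sum_f_mono) auto
  also have "\<dots> \<le> sum f (A \<union> B) + sum f D" using assms W_sub by (intro sum_f_Un_le) auto
  also have "sum f (A \<union> B) \<le> sum f A + sum f B" using assms W_sub by (intro sum_f_Un_le) auto
  finally show ?thesis by simp
qed

lemma last_start:
  assumes "S \<subseteq> W" "S \<noteq> {}"
  obtains k where "k \<in> S" "\<And>x. x \<in> S \<Longrightarrow> b x \<le> b k"
proof -
  have "finite (b ` S)" using assms finite_W finite_subset by blast
  then have "Max (b ` S) \<in> b ` S" "\<And>x. x \<in> S \<Longrightarrow> b x \<le> Max (b ` S)"
    using assms by auto
  then show ?thesis using that by (metis imageE)
qed

text \<open>The work up to and including \<open>k\<close> ends at \<open>b k + f k\<close>. A task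
  outside \<open>X\<close> that starts later has a larger \<open>s + a\<close> than
  \<open>k\<close>, so by priority it was not there at \<open>b k\<close>; packing from
  \<open>b k\<close> bounds all such tasks by \<open>C t - b k\<close>, and \<open>b k\<close>
  cancels.\<close>

lemma load_after:
  assumes k: "k \<in> W" and X: "X \<subseteq> W"
    and after: "\<And>x. x \<in> W \<Longrightarrow> a x \<le> t \<Longrightarrow> b k < b x \<Longrightarrow> x \<notin> X \<Longrightarrow> C t < s x + a x"
    and low: "s k + a k \<le> C t" and "b k \<le> C t"
  shows "p + load t \<le> C t + f k + sum f X"
proof -
  define Y where "Y = {x\<in>W. a x \<le> t \<and> b k < b x \<and> x \<notin> X}"
  have "sum f Y \<le> C t - b k"
  proof (rule late_sum)
    fix y assume y: "y \<in> Y"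
    then have big: "C t < s y + a y" using after by (auto simp: Y_def)
    moreover have "\<not> a y \<le> b k"
      using priority[OF k, of y] y big low by (auto simp: Y_def)
    ultimately show "b k \<le> a y \<and> a y \<le> t \<and> C t < s y + a y"
      using y by (auto simp: Y_def)
  qed (use assms in \<open>auto simp: Y_def\<close>)
  moreover have "load t \<le> sum f {y\<in>W. b y \<le> b k} + sum f X + sum f Y"
    by (rule sum_three_le) (use X in \<open>auto simp: Y_def\<close>)
  ultimately show ?thesis using sum_until[OF k] by linarith
qed

text \<open>All tasks arriving in \<open>(u, t]\<close> fall under the packing bound from
  \<open>r\<close>. Choosing \<open>r\<close> beyond \<open>u\<close> exploits a gap in the
  arrivals.\<close>

lemma load_split:
  assumes "u \<le> t"
    and "\<And>x. x \<in> W \<Longrightarrow> u < a x \<Longrightarrow> a x \<le> t \<Longrightarrow> r \<le> a x \<and> C t < s x + a x" and "r \<le> C t"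
  shows "load t \<le> load u + C t - r"
proof -
  have "load t \<le> sum f {x\<in>W. a x \<le> u} + sum f {x\<in>W. u < a x \<and> a x \<le> t} + sum f {}"
    by (rule sum_three_le) auto
  moreover have "sum f {x\<in>W. u < a x \<and> a x \<le> t} \<le> C t - r"
    by (rule late_sum) (use assms in auto)
  ultimately show ?thesis by (simp add: load_def)
qed

text \<open>Call a task low if \<open>s x + a x \<le> C t\<close>. The induction is on the number of
  low tasks of \<open>W\<close>, and its hypothesis is applied only at the arrival time of some low
  task that is no longer low with respect to the smaller optimum there.\<close>

lemma busy_load_bound:
  assumes "p \<le> t" "t \<le> C t"
  shows "p + load t \<le> \<phi> * C t"
  using assms
proof (induction "card {x\<in>W. s x + a x \<le> C t}" arbitrary: t rule: less_induct)
  case (less t)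
  define c where "c = C t"
  have tc: "p \<le> t" "t \<le> c" using less.prems by (auto simp: c_def)
  \<comment> \<open>The witness \<open>x\<close> is low at \<open>t\<close> but not at
    \<open>u\<close>, so the measure drops strictly.\<close>
  have IH: "p + load u \<le> \<phi> * C u"
    if "p \<le> u" "u \<le> C u" "u \<le> t" "x \<in> W" "C u < s x + a x" "s x + a x \<le> c" for u x
  proof (rule less.hyps)
    have "C u \<le> c" using that C_mono by (simp add: c_def)
    then have "{x\<in>W. s x + a x \<le> C u} \<subseteq> {x\<in>W. s x + a x \<le> C t}"
      by (auto simp: c_def)
    moreover have "x \<in> {x\<in>W. s x + a x \<le> C t} - {x\<in>W. s x + a x \<le> C u}"
      using that by (simp add: c_def)
    ultimately have "{x\<in>W. s x + a x \<le> C u} \<subset> {x\<in>W. s x + a x \<le> C t}" by blast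
    then show "card {x\<in>W. s x + a x \<le> C u} < card {x\<in>W. s x + a x \<le> C t}"
      using finite_W by (intro psubset_card_mono) auto
  qed (use that in auto)
  have c_nonneg: "0 \<le> c" using tc p_nonneg by linarith
  \<comment> \<open>The low tasks that have arrived are split according to whether they have started
    by \<open>t\<close>. All other arrived tasks are subject to packing.\<close>
  define P where "P = {x\<in>W. a x \<le> t \<and> b x \<le> t \<and> s x + a x \<le> c}"
  define J where "J = {x\<in>W. a x \<le> t \<and> t < b x \<and> s x + a x \<le> c}"
  have PJ: "x \<in> P \<or> x \<in> J \<or> c < s x + a x" if "x \<in> W" "a x \<le> t" for x
    using that by (auto simp: P_def J_def)
  show ?case
  proof (cases "J = {}")
    case J: True
    show ?thesis
    proof (cases "P = {}")
      case P: True
      \<comment> \<open>Without low tasks the whole load is packed: from \<open>p\<close> if nothing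
        arrives earlier, and otherwise from 0, where \<open>\<phi> * p \<le> f m \<le> C t\<close>
        makes room for \<open>p\<close>.\<close>
      have big: "C t < s x + a x" if "x \<in> W" "a x \<le> t" for x
        using PJ[OF that] P J by (simp add: c_def)
      show ?thesis
        using idle
      proof (elim disjE bexE conjE)
        assume A: "\<forall>x\<in>W. p \<le> a x"
        have "load t \<le> C t - p"
          unfolding load_def by (rule late_sum) (use A big less.prems in auto)
        then show ?thesis using phi_mult_ge[OF c_nonneg] by (simp add: c_def)
      next
        fix m assume m: "m \<in> N" "a m < p" "\<phi> * p \<le> f m"
        have "load t \<le> C t - 0"
          unfolding load_def by (rule late_sum) (use W_sub a_nonneg big c_nonneg c_def in auto)
        moreover have "\<phi> * p \<le> C t"
          using C_ge[OF m(1), of t] m tc a_nonneg[OF m(1)] by linarith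
        ultimately show ?thesis by (simp add: phi_mult_le_iff)
      qed
    next
      case False
      then obtain k where k: "k \<in> P" "\<And>x. x \<in> P \<Longrightarrow> b x \<le> b k"
        using last_start[of P] by (auto simp: P_def)
      then have kW: "k \<in> W" "b k \<le> t" "s k + a k \<le> c" by (auto simp: P_def)
      \<comment> \<open>Only tasks that are not low start after \<open>k\<close>, so the excess over
        \<open>C t\<close> is \<open>f k\<close> alone.\<close>
      have "p + load t \<le> C t + f k + sum f {}"
        by (rule load_after[OF kW(1)]) (use PJ J k kW tc c_def in force)+
      moreover have "\<phi> * (f k + a k) < c" using f_bound[of k c] kW by simp
      moreover have "0 \<le> \<phi> * a k" using phi_pos a_nonneg kW W_sub by (intro mult_nonneg_nonneg) auto
      ultimately have "\<phi> * f k \<le> C t" "p + load t \<le> C t + f k"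
        by (auto simp: c_def distrib_left)
      then show ?thesis by (simp add: phi_mult_le_iff)
    qed
  next
    case False
    have "finite (a ` J)" "a ` J \<noteq> {}" using False finite_W by (auto simp: J_def)
    then have "Max (a ` J) \<in> a ` J" "\<And>x. x \<in> J \<Longrightarrow> a x \<le> Max (a ` J)" by auto
    \<comment> \<open>The last arrival among the low tasks that have not started by \<open>t\<close>
      governs the remaining cases.\<close>
    then obtain n where n: "n \<in> J" and n_last: "\<And>x. x \<in> J \<Longrightarrow> a x \<le> a n"
      by (metis imageE)
    have nW: "n \<in> W" "n \<in> N" "a n \<le> t" "t < b n" "s n + a n \<le> c"
      using n W_sub by (auto simp: J_def)
    have Cn: "\<phi> * C (a n) < c" using arrival_bound[OF nW(1)] nW by simp
    show ?thesis
    proof (cases "\<exists>k\<in>P. a n \<le> b k")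
      case True
      then obtain k where k: "k \<in> P" "\<And>x. x \<in> P \<Longrightarrow> b x \<le> b k"
        using last_start[of P] by (auto simp: P_def)
      have kW: "k \<in> W" "k \<in> N" "b k \<le> t" "s k + a k \<le> c" "a k \<le> b k" "a n \<le> b k"
        using k True arrive W_sub by (auto simp: P_def intro: order_trans)
      \<comment> \<open>At \<open>v\<close> the task \<open>k\<close> and all of \<open>J\<close>
        have arrived, and none has started earlier. As \<open>v\<close> is the arrival time of
        \<open>n\<close> or \<open>k\<close>, \<open>\<phi> * C v < c\<close>; hence it suffices
        that these tasks have total length at most \<open>C v\<close>.\<close>
      define v where "v = max (a n) (a k)"
      have v: "a n \<le> v" "a k \<le> v" "v \<le> b k" "v = a n \<or> v = a k" "v \<le> t"
        using kW nW by (auto simp: v_def)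
      have Ck: "\<phi> * C (a k) < c" using arrival_bound[OF kW(1)] kW by simp
      have vC: "v \<le> C v"
        using v C_ge[of n v] C_ge[of k v] f_pos[of n] f_pos[of k] nW kW by auto
      have Cv_nonneg: "0 \<le> C v" using vC v a_nonneg[of n] nW by linarith
      have Cv: "\<phi> * C v < c" using v Cn Ck by auto
      have waitv: "\<phi> * C v < s x + v" if "x \<in> insert k J" for x
      proof (rule wait)
        show "a x \<le> v" using that n_last[of x] v(1,2) by auto
        show "v \<le> b x" using that v kW by (auto simp: J_def)
      qed (use that kW in \<open>auto simp: J_def\<close>)
      have kJ: "insert k J \<subseteq> {x\<in>W. a x \<le> v}"
        using kW v n_last by (force simp: J_def)
      have "sum f (insert k J) \<le> C v"
      proof (cases "\<phi> * v < C v")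
        \<comment> \<open>Here \<open>v\<close> is so small that waiting at \<open>v\<close> gives
          \<open>C v < s x\<close> for each of these tasks; they are packed from 0 in the optimum at
          \<open>v\<close>.\<close>
        case True
        then have "v + C v \<le> \<phi> * C v" using phi_mult_le_iff[of v "C v"] by simp
        then have "C v < s x + a x" if "x \<in> insert k J" for x
          using waitv[OF that] a_nonneg[of x] kJ that W_sub by force
        then have "sum f (insert k J) \<le> C v - 0"
          using kJ W_sub a_nonneg Cv_nonneg by (intro late_sum) auto
        then show ?thesis by simp
      next
        case late: False
        show ?thesis
        proof (cases "v < p")
          case True
          have "sum f (insert k J) \<le> load v"
            unfolding load_def using kJ W_sub by (intro sum_f_mono) auto
          then show ?thesis using early_load[OF True Cv_nonneg] by simp
        next
          case False
          \<comment> \<open>The witness is whichever of \<open>n\<close> and \<open>k\<close>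
            arrives at \<open>v\<close>.\<close>
          obtain x where "x \<in> W" "C v < s x + a x" "s x + a x \<le> c"
            using v arrival_bound[of n] arrival_bound[of k] kW nW phi_mult_ge[OF Cv_nonneg] by force
          then have "p + load v \<le> \<phi> * C v" using IH[of v] False vC v by simp
          \<comment> \<open>The machine is busy from \<open>p\<close> to \<open>v\<close>, so at
            least \<open>v - p\<close> of the load at \<open>v\<close> belongs to tasks started
            before \<open>v\<close>. This leaves at most \<open>\<phi> * C v - v \<le> C v\<close>
            for \<open>k\<close> and \<open>J\<close>.\<close>
          moreover have "sum f {y\<in>W. b y < v} + sum f (insert k J) \<le> load v"
          proof -
            have "sum f {y\<in>W. b y < v} + sum f (insert k J) = sum f ({y\<in>W. b y < v} \<union> insert k J)"
              using finite_W kW v by (intro sum.union_disjoint[symmetric]) (auto simp: J_def)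
            also have "\<dots> \<le> load v"
              unfolding load_def using kJ W_sub arrive by (intro sum_f_mono) force+
            finally show ?thesis .
          qed
          moreover have "v \<le> p + sum f {y\<in>W. b y < v}" using busy_until kW v by simp
          moreover have "\<phi> * C v \<le> v + C v"
            using late le_phi_mult_iff[of "C v" v] by simp
          ultimately show ?thesis by linarith
        qed
      qed
      moreover have "sum f (insert k J) = f k + sum f J"
        using kW finite_W by (subst sum.insert) (auto simp: J_def)
      moreover have "p + load t \<le> C t + f k + sum f J"
        by (rule load_after[OF kW(1)]) (use PJ k kW tc c_def J_def in force)+
      moreover have "C v + c \<le> \<phi> * c" using Cv phi_mult_le_iff[of "C v" c] by simp
      ultimately show ?thesis by (simp add: c_def)
    next
      case False
      \<comment> \<open>No low task arrives after \<open>a n\<close>: those in \<open>J\<close> by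
        the choice of \<open>n\<close>, those in \<open>P\<close> because they even start before
        \<open>a n\<close>.\<close>
      have new: "C t < s x + a x" if "x \<in> W" "a n < a x" "a x \<le> t" for x
        using PJ[of x] that False n_last[of x] arrive[of x] by (force simp: c_def)
      have Cn': "C (a n) + c \<le> \<phi> * c" using Cn phi_mult_le_iff[of "C (a n)" c] by simp
      have anC: "a n \<le> C (a n)" using C_ge[of n "a n"] f_pos[of n] nW by simp
      have Cn_nonneg: "0 \<le> C (a n)" using anC a_nonneg[of n] nW by linarith
      show ?thesis
      proof (cases "a n < p")
        case early: True
        \<comment> \<open>Since \<open>n\<close> arrives before \<open>p\<close>, the idle time
          before \<open>p\<close> must be due to a long task \<open>m\<close>.\<close>
        then obtain m where m: "m \<in> N" "a m < p" "\<phi> * p \<le> f m"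
          and m_max: "\<And>x. x \<in> W \<Longrightarrow> a x < p \<Longrightarrow> s x + a x \<le> s m + a m"
          using idle nW by force
        show ?thesis
        proof (cases "s m + a m \<le> c")
          case True
          \<comment> \<open>A low \<open>m\<close> dominates everything in \<open>W\<close> that
            arrives before \<open>p\<close>, so the tasks arriving after \<open>a n\<close>, not
            being low, arrive only from \<open>p\<close> on.\<close>
          have "load t \<le> load (a n) + C t - p"
          proof (rule load_split)
            fix x assume x: "x \<in> W" "a n < a x" "a x \<le> t"
            then show "p \<le> a x \<and> C t < s x + a x"
              using new[OF x] m_max[of x] True by (force simp: c_def)
          qed (use nW less.prems in auto)
          then show ?thesis using early_load[OF early Cn_nonneg] Cn' by (simp add: c_def)
        next
          case big: False
          \<comment> \<open>If \<open>m\<close> is not low, it is packed together with the tasks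
            arriving after \<open>v\<close>, from time \<open>a m\<close> on; its length
            \<open>f m \<ge> p\<close> pays for the summand \<open>p\<close>. The task
            \<open>m\<close> need not belong to \<open>W\<close>.\<close>
          define v where "v = max (a n) (a m)"
          have v: "a n \<le> v" "a m \<le> v" "v < p" "v \<le> t" using early m tc by (auto simp: v_def)
          have Cv_nonneg: "0 \<le> C v" using Cn_nonneg C_mono[OF v(1)] by linarith
          define Y where "Y = {x\<in>W. v < a x \<and> a x \<le> t}"
          have "load t \<le> sum f {x\<in>W. a x \<le> v} + sum f Y + sum f {}"
            by (rule sum_three_le) (auto simp: Y_def)
          moreover have "a m + sum f (insert m Y) \<le> C t"
          proof (rule pack)
            show "insert m Y \<subseteq> N" using m W_sub by (auto simp: Y_def)
            show "a m \<le> C t" using m tc c_def by simp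
            show "a m \<le> a y \<and> a y \<le> t \<and> C t < s y + a y" if "y \<in> insert m Y" for y
              using that big new v m tc by (auto simp: Y_def c_def)
          qed
          moreover have "sum f (insert m Y) = f m + sum f Y"
            using finite_W v by (subst sum.insert) (auto simp: Y_def)
          moreover have "load v \<le> C v" using early_load v Cv_nonneg by simp
          \<comment> \<open>The slack \<open>a m\<close> comes from packing from \<open>a m\<close>
            instead of 0. It is needed when \<open>v = a m\<close>, where only the waiting of
            \<open>n\<close> at time \<open>a m\<close> bounds \<open>C v\<close>.\<close>
          moreover have "C v + c \<le> \<phi> * c + a m"
          proof (cases "v = a n")
            case True
            then show ?thesis using Cn' a_nonneg[OF m(1)] by simp
          next
            case False
            then have vm: "v = a m" by (auto simp: v_def)
            have "\<phi> * C v < s n + v" using wait[of n v] nW v by simp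
            then have "\<phi> * C v \<le> c + a m" using nW a_nonneg[of n] vm by simp
            then have "\<phi> * (C v - a m) \<le> c"
              using phi_mult_ge[of "a m"] a_nonneg[OF m(1)] by (simp add: right_diff_distrib)
            then show ?thesis using phi_mult_le_iff[of "C v - a m" c] by simp
          qed
          moreover have "p \<le> f m" using m phi_mult_ge[OF p_nonneg] by simp
          ultimately show ?thesis by (simp add: load_def c_def)
        qed
      next
        case pn: False
        have split: "load t \<le> load (a n) + c - a n"
          unfolding c_def by (rule load_split) (use new nW tc c_def in auto)
        show ?thesis
        \<comment> \<open>If \<open>a n\<close> is late compared with the optimum there, the
          induction hypothesis at \<open>a n\<close> suffices; otherwise the load must be split at a
          later time.\<close>
        proof (cases "C (a n) \<le> \<phi> * a n")
          case True
          have "p + load (a n) \<le> \<phi> * C (a n)"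
            using IH[of "a n" n] pn anC nW arrival_bound[OF nW(1)] phi_mult_ge[OF Cn_nonneg] by simp
          moreover have "\<phi> * C (a n) \<le> C (a n) + a n"
            using True le_phi_mult_iff[of "C (a n)" "a n"] by simp
          ultimately show ?thesis using split Cn' by (simp add: c_def)
        next
          case small: False
          then have an_small: "a n + C (a n) < \<phi> * C (a n)"
            using le_phi_mult_iff[of "C (a n)" "a n"] by simp
          have "finite J" "J \<noteq> {}" using finite_W n by (auto simp: J_def)
          \<comment> \<open>The smallest value \<open>y\<close> of \<open>s + a\<close> in
            \<open>J\<close> serves as a threshold: a low task below it must already have
            started.\<close>
          then obtain q where q: "q \<in> J" and q_min: "\<And>x. x \<in> J \<Longrightarrow> s q + a q \<le> s x + a x"
            using arg_min_if_finite(1)[of J "\<lambda>x. s x + a x"] arg_min_least[of J _ "\<lambda>x. s x + a x"]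
            by blast
          have qW: "q \<in> W" "a q \<le> a n" "t < b q" "s q + a q \<le> c" "0 \<le> a q"
            using q n_last W_sub a_nonneg by (auto simp: J_def)
          define y where "y = s q + a q"
          have "C (a n) < y"
            using wait[of q "a n"] qW nW an_small by (simp add: y_def)
          \<comment> \<open>The time \<open>t1\<close> is the first arrival at which the optimum
            reaches \<open>y\<close>, and \<open>t0\<close> is the last arrival in \<open>W\<close>
            before \<open>t1\<close>. Thus \<open>W\<close> has no arrivals strictly between them,
            while \<open>C t0 < y \<le> C t1\<close>.\<close>
          define A where "A = {i\<in>N. a i \<le> t \<and> y \<le> C (a i)}"
          have "finite A" "A \<noteq> {}"
            using finite_N C_step[OF nW(2,3)] qW by (auto simp: A_def y_def c_def)
          then have "Min (a ` A) \<in> a ` A" and A_min: "\<And>i. i \<in> A \<Longrightarrow> Min (a ` A) \<le> a i"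
            by auto
          define t1 where "t1 = Min (a ` A)"
          have t1: "t1 \<le> t" "y \<le> C t1"
            using \<open>Min (a ` A) \<in> a ` A\<close> unfolding t1_def[symmetric] by (auto simp: A_def)
          have "a n < t1"
            using \<open>C (a n) < y\<close> t1(2) C_mono[of t1 "a n"] by linarith
          define B where "B = {x\<in>W. a x < t1}"
          have "finite B" "n \<in> B"
            using finite_W nW \<open>a n < t1\<close> by (auto simp: B_def)
          then have "Max (a ` B) \<in> a ` B" and B_max: "\<And>i. i \<in> B \<Longrightarrow> a i \<le> Max (a ` B)"
            by (auto intro!: Max_in)
          define t0 where "t0 = Max (a ` B)"
          have "t0 < t1" "a n \<le> t0" "t0 \<le> t"
            using \<open>Max (a ` B) \<in> a ` B\<close> B_max[OF \<open>n \<in> B\<close>] t1 unfolding t0_def[symmetric]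
            by (auto simp: B_def)
          have "C t0 < y"
          proof (rule ccontr)
            assume *: "\<not> C t0 < y"
            obtain x where x: "x \<in> B" "t0 = a x" using \<open>Max (a ` B) \<in> a ` B\<close> by (auto simp: t0_def)
            then have "x \<in> A" using * W_sub \<open>t0 \<le> t\<close> by (auto simp: A_def B_def)
            then show False using A_min x \<open>t0 < t1\<close> by (force simp: t1_def)
          qed
          have Ct0: "C (a n) \<le> C t0" using \<open>a n \<le> t0\<close> by (rule C_mono)
          define K where "K = {x\<in>W. a x \<le> t \<and> s x + a x \<le> C t0}"
          show ?thesis
          proof (cases "K = {}")
            case True
            have "load (a n) \<le> C (a n) - 0"
              unfolding load_def
            proof (rule late_sum)
              fix x assume x: "x \<in> {x\<in>W. a x \<le> a n}"
              then have "x \<notin> K" using True by simp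
              then show "0 \<le> a x \<and> a x \<le> a n \<and> C (a n) < s x + a x"
                using x nW Ct0 W_sub a_nonneg by (auto simp: K_def)
            qed (use Cn_nonneg in auto)
            then show ?thesis using split Cn' pn by (simp add: c_def)
          next
            case False
            then obtain k where k: "k \<in> K" "\<And>x. x \<in> K \<Longrightarrow> b x \<le> b k"
              using last_start[of K] by (auto simp: K_def)
            have kW: "k \<in> W" "a k \<le> t" "s k + a k \<le> C t0" "0 \<le> a k"
              using k W_sub a_nonneg by (auto simp: K_def)
            \<comment> \<open>Lying below the threshold \<open>y\<close>, \<open>k\<close> has
              started by \<open>t\<close>, hence before \<open>a n\<close>, and
              \<open>load_after\<close> applies at \<open>t0\<close>.\<close>
            have "k \<notin> J" using q_min[of k] kW \<open>C t0 < y\<close> by (auto simp: y_def)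
            then have "k \<in> P" using PJ[OF kW(1,2)] kW \<open>C t0 < y\<close> qW by (auto simp: y_def)
            then have bk: "b k < a n" using \<open>\<not> (\<exists>k\<in>P. a n \<le> b k)\<close> by force
            have "p + load t0 \<le> C t0 + f k + sum f {}"
            proof (rule load_after[OF kW(1)])
              fix x assume x: "x \<in> W" "a x \<le> t0" "b k < b x"
              then have "x \<notin> K" using k(2)[of x] by auto
              then show "C t0 < s x + a x" using x \<open>t0 \<le> t\<close> by (auto simp: K_def)
            qed (use kW bk anC Ct0 in auto)
            moreover have "load t \<le> load t0 + C t - t1"
            proof (rule load_split)
              fix x assume x: "x \<in> W" "t0 < a x" "a x \<le> t"
              then have "x \<notin> B" using B_max[of x] by (auto simp: t0_def)
              then show "t1 \<le> a x \<and> C t < s x + a x"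
                using x new[of x] \<open>a n < t1\<close> by (auto simp: B_def)
            qed (use \<open>t0 \<le> t\<close> t1 less.prems in auto)
            \<comment> \<open>Waiting of \<open>q\<close> at \<open>t0\<close> and at
              \<open>t1\<close> gives facts 1 and 2. The length of \<open>k\<close> is bounded in 3
              through \<open>y\<close> and in 4 through its start before \<open>a q\<close>. The
              weights \<open>\<phi> - 1\<close> and
              \<open>2 - \<phi> = (\<phi> - 1) * (\<phi> - 1)\<close> make \<open>y\<close> cancel
              and the bounds 3 and 4 add up to one on \<open>\<phi> * f k\<close>.\<close>
            moreover have "\<phi> * (C t0 + f k - t1) \<le> c"
            proof -
              have "\<phi> * C t0 < s q + t0"
                using wait[of q t0] qW \<open>a n \<le> t0\<close> \<open>t0 \<le> t\<close> by simp
              then have 1: "\<phi> * C t0 < c - a q + t1" using qW \<open>t0 < t1\<close> by simp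
              have "\<phi> * C t1 < s q + t1"
                using wait[of q t1] qW \<open>a n < t1\<close> t1 by simp
              moreover have "\<phi> * y \<le> \<phi> * C t1" using t1 phi_pos by simp
              ultimately have "\<phi> * y - y + a q \<le> t1" by (simp add: y_def)
              then have "(\<phi> - 1) * (\<phi> * y - y + a q) \<le> (\<phi> - 1) * t1"
                using phi_gt_1 by simp
              then have 2: "2 * y - \<phi> * y + \<phi> * a q - a q \<le> \<phi> * t1 - t1"
                by (simp add: algebra_simps phi_phi_mult)
              have "\<phi> * (f k + a k) < C t0" using f_bound kW by simp
              then have "\<phi> * f k \<le> y"
                using \<open>C t0 < y\<close> phi_mult_ge[OF kW(4)] kW(4) by (simp add: distrib_left)
              then have "(2 - \<phi>) * (\<phi> * f k) \<le> (2 - \<phi>) * y"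
                using phi_less_2 by simp
              then have 3: "\<phi> * f k - f k \<le> 2 * y - \<phi> * y"
                by (simp add: algebra_simps phi_phi_mult)
              have "b k < a q"
                using priority[OF kW(1) qW(1)] bk qW nW kW \<open>C t0 < y\<close> by (force simp: y_def)
              then have "\<phi> * b k \<le> \<phi> * a q" using phi_pos by simp
              then have 4: "f k \<le> \<phi> * a q" using ripe[OF kW(1)] by simp
              have "\<phi> * (C t0 + f k - t1) = \<phi> * C t0 + \<phi> * f k - \<phi> * t1"
                by (simp add: algebra_simps)
              then show ?thesis using 1 2 3 4 by linarith
            qed
            ultimately show ?thesis by (simp add: phi_mult_le_iff c_def)
          qed
        qed
      qed
    qed
  qed
qed

text \<open>Meant for \<open>t\<close> equal to the optimum of the whole process, when everything
  has arrived, so that the load at \<open>t\<close> contains all the work up to the end of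
  \<open>x\<close>.\<close>

corollary completion_bound:
  assumes x: "x \<in> W" and t: "C t = t" "\<And>i. i \<in> N \<Longrightarrow> a i \<le> t"
  shows "b x + f x \<le> \<phi> * t"
proof -
  have "p \<le> t"
    using idle
  proof (elim disjE bexE conjE)
    assume A: "\<forall>x\<in>W. p \<le> a x"
    then show ?thesis using x t(2) W_sub by (meson order_trans subsetD)
  next
    fix m assume m: "m \<in> N" "\<phi> * p \<le> f m"
    then show ?thesis
      using C_ge[OF m(1) t(2)[OF m(1)]] a_nonneg[OF m(1)] t(1) phi_mult_ge[OF p_nonneg] by linarith
  qed
  then have "p + load t \<le> \<phi> * t" using busy_load_bound[of t] t(1) by simp
  moreover have "sum f {y\<in>W. b y \<le> b x} \<le> load t"
    unfolding load_def using t(2) W_sub by (intro sum_f_mono) auto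
  ultimately show ?thesis using sum_until[OF x] by linarith
qed

end

section \<open>The offline optimum\<close>

text \<open>Remove the interval that starts last; the others end by its start, which becomes the new
  right end.\<close>

lemma sum_disjoint_intervals_le:
  fixes b f :: "'i \<Rightarrow> real"
  assumes "finite Y"
    and "\<And>y. y \<in> Y \<Longrightarrow> r \<le> b y \<and> b y + f y \<le> c \<and> 0 < f y"
    and "\<And>x y. x \<in> Y \<Longrightarrow> y \<in> Y \<Longrightarrow> x \<noteq> y \<Longrightarrow> b x + f x \<le> b y \<or> b y + f y \<le> b x"
    and "r \<le> c"
  shows "r + sum f Y \<le> c"
  using assms
proof (induction "card Y" arbitrary: Y c)
  case 0
  then show ?case by simp
next
  case (Suc n)
  then have "Y \<noteq> {}" by auto
  define k where "k = arg_min_on (\<lambda>y. - b y) Y"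
  have k: "k \<in> Y" "\<And>y. y \<in> Y \<Longrightarrow> b y \<le> b k"
    using arg_min_if_finite(1)[OF Suc.prems(1) \<open>Y \<noteq> {}\<close>, of "\<lambda>y. - b y"]
      arg_min_least[OF Suc.prems(1) \<open>Y \<noteq> {}\<close>, of _ "\<lambda>y. - b y"] by (auto simp: k_def)
  have "r + sum f (Y - {k}) \<le> b k"
  proof (rule Suc.hyps(1))
    show "n = card (Y - {k})" using Suc.hyps(2) k Suc.prems(1) by simp
    show "r \<le> b y \<and> b y + f y \<le> b k \<and> 0 < f y" if "y \<in> Y - {k}" for y
      using Suc.prems(2)[of y] Suc.prems(2)[of k] Suc.prems(3)[of y k] k that by force
  qed (use Suc.prems k in auto)
  moreover have "sum f Y = f k + sum f (Y - {k})"
    using k Suc.prems(1) by (simp add: sum.remove)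
  ultimately show ?case using Suc.prems(2)[OF k(1)] by linarith
qed

lemma valid_task_nth: "TAP T \<Longrightarrow> i < length T \<Longrightarrow> valid_task (T ! i)"
  by (simp add: TAP_def)

lemma finite_completion_times:
  "finite {b + run_time m (T ! i) | i m b. i < length T \<and> \<sigma> i = Some (m, b)}"
proof (rule finite_subset)
  show "{b + run_time m (T ! i) | i m b. i < length T \<and> \<sigma> i = Some (m, b)}
    \<subseteq> (\<lambda>i. snd (the (\<sigma> i)) + run_time (fst (the (\<sigma> i))) (T ! i)) ` {..<length T}"
    by force
qed simp

lemma completion_time_ge:
  "i < length T \<Longrightarrow> \<sigma> i = Some (m, b) \<Longrightarrow> b + run_time m (T ! i) \<le> completion_time T \<sigma>"
  unfolding completion_time_def using finite_completion_times by (intro Max_ge) auto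

lemma completion_time_nonneg: "0 \<le> completion_time T \<sigma>"
  unfolding completion_time_def using finite_completion_times by (intro Max_ge) auto

lemma completion_time_le:
  assumes "0 \<le> c"
    and "\<And>i m b. i < length T \<Longrightarrow> \<sigma> i = Some (m, b) \<Longrightarrow> b + run_time m (T ! i) \<le> c"
  shows "completion_time T \<sigma> \<le> c"
  unfolding completion_time_def using finite_completion_times assms by (subst Max_le_iff) auto

lemma completion_times_nonempty: "{completion_time T \<sigma> | \<sigma>. valid_schedule T \<sigma>} \<noteq> {}"
proof -
  have "valid_schedule T (\<lambda>i. if i < length T then Some (Slow i, arrival (T ! i)) else None)"
    by (auto simp: valid_schedule_def split: if_splits)
  then show ?thesis by blast
qed

lemma completion_times_bdd_below: "bdd_below {completion_time T \<sigma> | \<sigma>. valid_schedule T \<sigma>}"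
  by (rule bdd_belowI[of _ 0]) (auto simp: completion_time_nonneg)

lemma opt_le: "valid_schedule T \<sigma> \<Longrightarrow> opt T \<le> completion_time T \<sigma>"
  unfolding opt_def by (rule cInf_lower[OF _ completion_times_bdd_below]) auto

lemma opt_greatest: "(\<And>\<sigma>. valid_schedule T \<sigma> \<Longrightarrow> c \<le> completion_time T \<sigma>) \<Longrightarrow> c \<le> opt T"
  unfolding opt_def by (rule cInf_greatest[OF completion_times_nonempty]) auto

lemma opt_nonneg: "0 \<le> opt T"
  by (rule opt_greatest) (rule completion_time_nonneg)

text \<open>As \<open>opt\<close> is an infimum, a schedule strictly below a given larger bound
  takes the place of an optimal one.\<close>

lemma opt_approx:
  assumes "opt T < c"
  obtains \<sigma> where "valid_schedule T \<sigma>" "completion_time T \<sigma> < c"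
  using assms opt_greatest[of T c] by (meson not_le)

lemma valid_schedule_started:
  assumes "valid_schedule T \<sigma>" "i < length T"
  obtains m b where "\<sigma> i = Some (m, b)" "arrival (T ! i) \<le> b"
proof -
  have "i \<in> dom \<sigma>" using assms by (simp add: valid_schedule_def)
  then obtain m b where "\<sigma> i = Some (m, b)" by auto
  then show ?thesis using that assms by (auto simp: valid_schedule_def)
qed

section \<open>Lower bounds and monotonicity of the optimum\<close>

lemma opt_ge_task:
  assumes "TAP T" "i < length T"
  shows "arrival (T ! i) + fast_time (T ! i) \<le> opt T"
proof (rule opt_greatest)
  fix \<sigma> assume "valid_schedule T \<sigma>"
  then obtain m b where *: "\<sigma> i = Some (m, b)" "arrival (T ! i) \<le> b"
    using assms by (elim valid_schedule_started)
  have "fast_time (T ! i) \<le> run_time m (T ! i)"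
    using valid_task_nth[OF assms] by (cases m) (auto simp: valid_task_def)
  then show "arrival (T ! i) + fast_time (T ! i) \<le> completion_time T \<sigma>"
    using completion_time_ge[OF assms(2), of \<sigma> m b] * by linarith
qed

lemma opt_take_le: "opt (take n T) \<le> opt T"
proof (rule opt_greatest)
  fix \<sigma> assume v: "valid_schedule T \<sigma>"
  define \<sigma>' where "\<sigma>' = \<sigma> |` {..<length (take n T)}"
  have eq: "\<sigma>' i = Some x \<longleftrightarrow> i < n \<and> i < length T \<and> \<sigma> i = Some x" for i x
    by (auto simp: \<sigma>'_def restrict_map_def)
  have "dom \<sigma>' = {..<length (take n T)}"
    using v by (auto simp: \<sigma>'_def valid_schedule_def)
  then have "valid_schedule (take n T) \<sigma>'"
    using v by (auto simp: valid_schedule_def eq nth_take)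
  then have "opt (take n T) \<le> completion_time (take n T) \<sigma>'"
    by (rule opt_le)
  also have "\<dots> \<le> completion_time T \<sigma>"
    by (rule completion_time_le) (auto simp: completion_time_nonneg eq completion_time_ge)
  finally show "opt (take n T) \<le> completion_time T \<sigma>" .
qed

text \<open>If the bound failed, some schedule would end before \<open>?z\<close> and before every
  \<open>slow_time + arrival\<close> of the finite set \<open>Y\<close>. It cannot run a task of
  \<open>Y\<close> on a slow machine, so these tasks occupy disjoint intervals of the fast machine
  after \<open>r\<close>, and it ends no earlier than \<open>?z\<close>.\<close>

lemma opt_pack:
  assumes T: "TAP T" and Y: "Y \<subseteq> {..<length T}"
    and big: "\<And>y. y \<in> Y \<Longrightarrow> r \<le> arrival (T ! y) \<and> opt T < slow_time (T ! y) + arrival (T ! y)"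
    and "r \<le> opt T"
  shows "r + (\<Sum>y\<in>Y. fast_time (T ! y)) \<le> opt T"
proof (rule ccontr)
  let ?z = "r + (\<Sum>y\<in>Y. fast_time (T ! y))"
  let ?Z = "insert ?z ((\<lambda>y. slow_time (T ! y) + arrival (T ! y)) ` Y)"
  assume "\<not> ?z \<le> opt T"
  have fin: "finite Y" using Y finite_subset by blast
  then have "opt T < Min ?Z"
    using big \<open>\<not> ?z \<le> opt T\<close> by (subst Min_gr_iff) auto
  then obtain \<sigma> where v: "valid_schedule T \<sigma>" and less: "completion_time T \<sigma> < Min ?Z"
    by (rule opt_approx)
  have below: "completion_time T \<sigma> < z" if "z \<in> ?Z" for z
    using less Min_le[of ?Z z] that fin by (meson finite_imageI finite_insert less_le_trans)
  define b where "b y = snd (the (\<sigma> y))" for y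
  have fast: "\<sigma> y = Some (Fast, b y) \<and> arrival (T ! y) \<le> b y" if "y \<in> Y" for y
  proof -
    have y: "y < length T" using that Y by auto
    obtain m c where *: "\<sigma> y = Some (m, c)" "arrival (T ! y) \<le> c"
      using valid_schedule_started[OF v y] .
    have "m = Fast"
    proof (cases m)
      case (Slow k)
      then show ?thesis
        using completion_time_ge[OF y, of \<sigma> m c] *(1) below[of "slow_time (T ! y) + arrival (T ! y)"] that *(2)
        by auto
    qed
    then show ?thesis using * by (simp add: b_def)
  qed
  have "?z \<le> completion_time T \<sigma>"
  proof (rule sum_disjoint_intervals_le[OF fin])
    show "r \<le> b y \<and> b y + fast_time (T ! y) \<le> completion_time T \<sigma> \<and> 0 < fast_time (T ! y)"
      if "y \<in> Y" for y
      using fast[OF that] big[OF that] completion_time_ge[of y T \<sigma> Fast "b y"] that Y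
        valid_task_nth[OF T, of y] by (auto simp: valid_task_def)
    show "b x + fast_time (T ! x) \<le> b y \<or> b y + fast_time (T ! y) \<le> b x"
      if "x \<in> Y" "y \<in> Y" "x \<noteq> y" for x y
    proof -
      have "b x + run_time Fast (T ! x) \<le> b y \<or> b y + run_time Fast (T ! y) \<le> b x"
        using v fast that unfolding valid_schedule_def by blast
      then show ?thesis by simp
    qed
    show "r \<le> completion_time T \<sigma>" using assms(4) opt_le[OF v] by simp
  qed
  then show False using below[of ?z] by simp
qed

section \<open>Revealed tasks\<close>

lemma revealed_eq_takeWhile:
  assumes "TAP T" shows "revealed T t = takeWhile (\<lambda>x. arrival x \<le> t) T"
proof -
  have "sorted (map arrival T)" using assms by (simp add: TAP_def)
  then show ?thesis
    unfolding revealed_def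
  proof (induction T)
    case (Cons x T)
    show ?case
    proof (cases "arrival x \<le> t")
      case True
      then show ?thesis using Cons by simp
    next
      case False
      then have "filter (\<lambda>x. arrival x \<le> t) T = []"
        using Cons.prems by (force simp: filter_empty_conv)
      then show ?thesis using False by simp
    qed
  qed simp
qed

lemma revealed_eq_take:
  assumes "TAP T" shows "revealed T t = take (length (revealed T t)) T"
  unfolding revealed_eq_takeWhile[OF assms] by (rule takeWhile_eq_take)

lemma less_length_revealed_iff:
  assumes "TAP T"
  shows "i < length (revealed T t) \<longleftrightarrow> i < length T \<and> arrival (T ! i) \<le> t"
proof -
  have s: "sorted (map arrival T)" using assms by (simp add: TAP_def)
  then have "i < length (takeWhile (\<lambda>x. arrival x \<le> t) T) \<longleftrightarrow> i < length T \<and> arrival (T ! i) \<le> t"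
  proof (induction T arbitrary: i)
    case (Cons x T)
    then show ?case by (cases i) (auto simp: nth_Cons' intro: order_trans)
  qed simp
  then show ?thesis by (simp add: revealed_eq_takeWhile[OF assms])
qed

lemma nth_revealed:
  assumes "TAP T" "i < length (revealed T t)"
  shows "revealed T t ! i = T ! i"
  using revealed_eq_take[OF assms(1), of t] assms(2) by (metis nth_take)

lemma TAP_revealed: "TAP T \<Longrightarrow> TAP (revealed T t)"
  by (auto simp: TAP_def revealed_def sorted_filter)

lemma opt_revealed_mono:
  assumes "TAP T" "u \<le> v"
  shows "opt (revealed T u) \<le> opt (revealed T v)"
proof -
  have "revealed T u = revealed (revealed T v) u"
    using assms(2) by (auto simp: revealed_def intro!: filter_cong)
  then show ?thesis
    using revealed_eq_take[OF TAP_revealed[OF assms(1)], of v u] opt_take_le by metis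
qed

lemma opt_revealed_le: "TAP T \<Longrightarrow> opt (revealed T t) \<le> opt T"
  using revealed_eq_take[of T t] opt_take_le by metis

section \<open>Schedules produced by H\<close>

lemma fast_candidates_disjoint: "fast_candidates t R h \<inter> slow_starts t R h = {}"
  by (auto simp: fast_candidates_def Let_def)

lemma fast_candidatesD:
  assumes "i \<in> fast_candidates t R h"
  shows "i \<in> standby R h" "i \<notin> slow_starts t R h" "fast_free t R h" "fast_time (R ! i) / \<phi> \<le> t"
    and "\<And>j. j \<in> standby R h \<Longrightarrow> j \<notin> slow_starts t R h \<Longrightarrow>
           slow_time (R ! j) + arrival (R ! j) \<le> slow_time (R ! i) + arrival (R ! i)"
  using assms by (auto simp: fast_candidates_def Let_def)

lemma H_slowD:
  assumes "d \<in> H t R h" "d i = Some (Slow k)"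
  shows "i \<in> slow_starts t R h" "\<And>j b. h j \<noteq> Some (Slow k, b)" "\<And>j. d j = Some (Slow k) \<Longrightarrow> j = i"
proof -
  obtain F where F: "dom d = slow_starts t R h \<union> F" "\<forall>i\<in>F. d i = Some Fast"
    "\<forall>i\<in>slow_starts t R h. \<exists>k. d i = Some (Slow k) \<and> (\<forall>j b. h j \<noteq> Some (Slow k, b))"
    "\<forall>i j k. d i = Some (Slow k) \<longrightarrow> d j = Some (Slow k) \<longrightarrow> i = j"
    using assms(1) unfolding H_def by blast
  have "i \<in> dom d" using assms(2) by auto
  then show i: "i \<in> slow_starts t R h" using F assms(2) by auto
  show "\<And>j b. h j \<noteq> Some (Slow k, b)" using F(3) i assms(2) by force
  show "\<And>j. d j = Some (Slow k) \<Longrightarrow> j = i" using F(4) assms(2) by blast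
qed

lemma H_fastD:
  assumes "d \<in> H t R h" "d i = Some Fast"
  shows "i \<in> fast_candidates t R h" "\<And>j. d j = Some Fast \<Longrightarrow> j = i"
proof -
  obtain F where F: "if fast_candidates t R h = {} then F = {} else \<exists>i\<in>fast_candidates t R h. F = {i}"
    "dom d = slow_starts t R h \<union> F"
    "\<forall>i\<in>slow_starts t R h. \<exists>k. d i = Some (Slow k) \<and> (\<forall>j b. h j \<noteq> Some (Slow k, b))"
    using assms(1) unfolding H_def by blast
  have in_F: "j \<in> F" if "d j = Some Fast" for j
  proof -
    have "j \<in> dom d" using that by auto
    then show ?thesis using F that by force
  qed
  show "i \<in> fast_candidates t R h" "\<And>j. d j = Some Fast \<Longrightarrow> j = i"
    using F(1) in_F assms(2) by (auto split: if_splits)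
qed

lemma H_slow_starts:
  assumes "d \<in> H t R h" "i \<in> slow_starts t R h"
  obtains k where "d i = Some (Slow k)"
  using assms unfolding H_def by blast

lemma H_fast_candidates:
  assumes "d \<in> H t R h" "fast_candidates t R h \<noteq> {}"
  obtains i where "d i = Some Fast"
  using assms unfolding H_def by auto

locale H_run =
  fixes T :: "task list" and \<sigma> :: schedule
  assumes TAP: "TAP T" and produces: "produces H T \<sigma>"
begin

abbreviation f where "f i \<equiv> fast_time (T ! i)"
abbreviation s where "s i \<equiv> slow_time (T ! i)"
abbreviation a where "a i \<equiv> arrival (T ! i)"
abbreviation C where "C t \<equiv> opt (revealed T t)"

text \<open>This is the standby set seen by H at \<open>t\<close> before it acts, so a task started
  at \<open>t\<close> itself still counts.\<close>

definition waiting :: "real \<Rightarrow> nat \<Rightarrow> bool" where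
  "waiting t i \<longleftrightarrow> i < length T \<and> a i \<le> t \<and> (\<forall>m b. \<sigma> i = Some (m, b) \<longrightarrow> t \<le> b)"

lemma task_pos: "i < length T \<Longrightarrow> 0 < f i" "i < length T \<Longrightarrow> 0 \<le> a i"
  using valid_task_nth[OF TAP, of i] by (auto simp: valid_task_def)

lemma waiting_iff: "waiting t i \<longleftrightarrow> i \<in> standby (revealed T t) (started_before \<sigma> t)"
  by (auto simp: waiting_def standby_def less_length_revealed_iff[OF TAP] started_before_def
      split: option.splits if_splits)

lemma nth_revealed_waiting: "waiting t i \<Longrightarrow> revealed T t ! i = T ! i"
  using nth_revealed[OF TAP] by (simp add: waiting_iff standby_def)

section \<open>The rules of H read off a produced schedule\<close>

lemma decision: "0 \<le> t \<Longrightarrow> started_at \<sigma> t \<in> H t (revealed T t) (started_before \<sigma> t)"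
  using produces by (simp add: produces_def)

lemma start_nonneg: "\<sigma> i = Some (m, b) \<Longrightarrow> 0 \<le> b"
  using produces by (auto simp: produces_def)

lemma started_at_iff: "started_at \<sigma> t i = Some m \<longleftrightarrow> \<sigma> i = Some (m, t)"
  by (auto simp: started_at_def split: option.splits)

lemma started_before_iff: "started_before \<sigma> t i = Some (m, b) \<longleftrightarrow> \<sigma> i = Some (m, b) \<and> b < t"
  by (auto simp: started_before_def split: option.splits if_splits)

lemma slow_starts_iff:
  "i \<in> slow_starts t (revealed T t) (started_before \<sigma> t) \<longleftrightarrow> waiting t i \<and> s i + t \<le> \<phi> * C t"
  using nth_revealed_waiting[of t i] by (auto simp: slow_starts_def waiting_iff[symmetric])

lemma slow_start:
  assumes "\<sigma> i = Some (Slow k, b)"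
  shows "waiting b i" "s i + b \<le> \<phi> * C b"
  using H_slowD(1)[OF decision, of b i k] start_nonneg[OF assms] assms
  by (auto simp: started_at_iff slow_starts_iff)

text \<open>No slow machine is reused: H takes machines absent from the history, and distinct ones
  for simultaneous starts.\<close>

lemma slow_machine_unique:
  assumes "\<sigma> i = Some (Slow k, b)" "\<sigma> j = Some (Slow k, c)"
  shows "i = j"
proof -
  have "i = j" if "\<sigma> i = Some (Slow k, b)" "\<sigma> j = Some (Slow k, c)" "b \<le> c" for i j b c
  proof (cases "b = c")
    case True
    then show ?thesis
      using H_slowD(3)[OF decision, of c j k i] start_nonneg[OF that(2)] that by (simp add: started_at_iff)
  next
    case False
    then show ?thesis
      using H_slowD(2)[OF decision, of c j k i b] start_nonneg[OF that(2)] that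
      by (simp add: started_at_iff started_before_iff)
  qed
  then show ?thesis using assms by (metis linear)
qed

lemma fast_start:
  assumes "\<sigma> i = Some (Fast, b)"
  shows "waiting b i" "f i \<le> \<phi> * b"
    and "\<And>j c. \<sigma> j = Some (Fast, c) \<Longrightarrow> c < b \<Longrightarrow> c + f j \<le> b"
    and "\<And>j. \<sigma> j = Some (Fast, b) \<Longrightarrow> j = i"
    and "\<And>j. waiting b j \<Longrightarrow> \<phi> * C b < s j + b \<Longrightarrow> s j + a j \<le> s i + a i"
proof -
  have d: "started_at \<sigma> b i = Some Fast" and b: "0 \<le> b"
    using assms start_nonneg by (auto simp: started_at_iff)
  note cand = H_fastD(1)[OF decision[OF b] d]
  note * = fast_candidatesD[OF cand]
  show w: "waiting b i" using *(1) by (simp add: waiting_iff)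
  show "f i \<le> \<phi> * b"
    using *(4) nth_revealed_waiting[OF w] phi_pos by (simp add: field_simps)
  show "c + f j \<le> b" if "\<sigma> j = Some (Fast, c)" "c < b" for j c
  proof -
    have "started_at \<sigma> c j = Some Fast" "0 \<le> c"
      using that start_nonneg by (auto simp: started_at_iff)
    then have "waiting c j"
      using fast_candidatesD(1)[OF H_fastD(1)[OF decision]] by (simp add: waiting_iff)
    then have "j < length (revealed T b)"
      using that by (auto simp: waiting_def less_length_revealed_iff[OF TAP])
    then have "revealed T b ! j = T ! j" by (rule nth_revealed[OF TAP])
    then show ?thesis using *(3) that by (force simp: fast_free_def started_before_iff)
  qed
  show "j = i" if "\<sigma> j = Some (Fast, b)" for j
    using H_fastD(2)[OF decision[OF b] d, of j] that by (simp add: started_at_iff)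
  show "s j + a j \<le> s i + a i" if "waiting b j" "\<phi> * C b < s j + b" for j
    using *(5)[of j] that w nth_revealed_waiting[of b] by (auto simp: waiting_iff[symmetric] slow_starts_iff)
qed

text \<open>Had the slow rule applied at \<open>u\<close>, the task would have been started on a
  slow machine at that moment.\<close>

lemma fast_waits:
  assumes "\<sigma> i = Some (Fast, b)" "a i \<le> u" "u \<le> b"
  shows "waiting u i" "\<phi> * C u < s i + u"
proof -
  show w: "waiting u i" using fast_start(1)[OF assms(1)] assms by (auto simp: waiting_def)
  show "\<phi> * C u < s i + u"
  proof (rule ccontr)
    assume "\<not> ?thesis"
    then have i: "i \<in> slow_starts u (revealed T u) (started_before \<sigma> u)"
      using w by (simp add: slow_starts_iff)
    have "0 \<le> u" using w task_pos(2)[of i] assms by (auto simp: waiting_def)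
    then obtain k where "started_at \<sigma> u i = Some (Slow k)"
      using H_slow_starts[OF decision i] by blast
    then show False using assms by (simp add: started_at_iff)
  qed
qed

lemma started_waiting: "\<sigma> i = Some (m, b) \<Longrightarrow> waiting b i"
  using slow_start(1) fast_start(1) by (cases m) auto

lemma finite_dom: "finite (dom \<sigma>)"
proof (rule finite_subset)
  show "dom \<sigma> \<subseteq> {..<length T}" using started_waiting by (force simp: waiting_def)
qed simp

text \<open>With the fast machine free and no fast start at \<open>t\<close>, the candidate set must
  be empty. A task \<open>m\<close> of highest priority meets every condition except rule (c), so it
  is too long for time \<open>t\<close>.\<close>

lemma blocked:
  assumes t: "0 \<le> t" and w: "waiting t w" "\<phi> * C t < s w + t"
    and free: "\<And>i b. \<sigma> i = Some (Fast, b) \<Longrightarrow> b < t \<Longrightarrow> b + f i \<le> t"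
    and no_start: "\<And>i. \<sigma> i \<noteq> Some (Fast, t)"
  obtains m where "waiting t m" "\<phi> * t < f m"
    "\<And>j. waiting t j \<Longrightarrow> \<phi> * C t < s j + t \<Longrightarrow> s j + a j \<le> s m + a m"
proof -
  define S where "S = {i. waiting t i \<and> \<phi> * C t < s i + t}"
  have "S \<subseteq> {..<length T}" by (auto simp: S_def waiting_def)
  then have "finite S" "S \<noteq> {}" using w finite_subset by (auto simp: S_def)
  then obtain m where m: "m \<in> S" and max: "\<And>j. j \<in> S \<Longrightarrow> - (s m + a m) \<le> - (s j + a j)"
    using arg_min_if_finite(1)[of S "\<lambda>i. - (s i + a i)"] arg_min_least[of S _ "\<lambda>i. - (s i + a i)"]
    by blast
  have "fast_free t (revealed T t) (started_before \<sigma> t)"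
    unfolding fast_free_def
  proof (intro allI impI)
    fix i b assume "started_before \<sigma> t i = Some (Fast, b)"
    then have i: "\<sigma> i = Some (Fast, b)" "b < t" by (auto simp: started_before_iff)
    then have "i < length (revealed T t)"
      using started_waiting[OF i(1)] by (auto simp: waiting_def less_length_revealed_iff[OF TAP])
    then show "b + fast_time (revealed T t ! i) \<le> t"
      using nth_revealed[OF TAP] free[OF i] by simp
  qed
  moreover have "fast_candidates t (revealed T t) (started_before \<sigma> t) = {}"
  proof (rule ccontr)
    assume "fast_candidates t (revealed T t) (started_before \<sigma> t) \<noteq> {}"
    then obtain i where "started_at \<sigma> t i = Some Fast" by (rule H_fast_candidates[OF decision[OF t]])
    then show False using no_start by (simp add: started_at_iff)
  qed
  moreover have "m \<in> standby (revealed T t) (started_before \<sigma> t)"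
    "m \<notin> slow_starts t (revealed T t) (started_before \<sigma> t)"
    using m by (auto simp: S_def slow_starts_iff waiting_iff[symmetric])
  moreover have "slow_time (revealed T t ! j) + arrival (revealed T t ! j)
      \<le> slow_time (revealed T t ! m) + arrival (revealed T t ! m)"
    if "j \<in> standby (revealed T t) (started_before \<sigma> t)"
      "j \<notin> slow_starts t (revealed T t) (started_before \<sigma> t)" for j
    using that max[of j] m nth_revealed_waiting[of t]
    by (auto simp: waiting_iff[symmetric] slow_starts_iff S_def)
  ultimately have "\<not> fast_time (revealed T t ! m) / \<phi> \<le> t"
    by (auto simp: fast_candidates_def Let_def)
  then have "\<phi> * t < f m"
    using m nth_revealed_waiting[of t m] phi_pos by (auto simp: S_def field_simps)
  moreover have "s j + a j \<le> s m + a m" if "waiting t j" "\<phi> * C t < s j + t" for j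
    using max[of j] that by (simp add: S_def)
  ultimately show ?thesis using that m unfolding S_def by blast
qed

text \<open>Take \<open>t\<close> beyond all starts, ends, arrivals and values
  \<open>f i / \<phi>\<close>. An unstarted task would then be blocked by a task \<open>m\<close>
  with \<open>t < f m / \<phi>\<close>, which is impossible.\<close>

lemma all_started:
  assumes w: "w < length T" shows "\<sigma> w \<noteq> None"
proof
  assume None: "\<sigma> w = None"
  define E where "E = (\<lambda>i. snd (the (\<sigma> i)) + f i) ` dom \<sigma> \<union> (\<lambda>i. snd (the (\<sigma> i))) ` dom \<sigma>
    \<union> a ` {..<length T} \<union> (\<lambda>i. f i / \<phi>) ` {..<length T} \<union> {0}"
  define t where "t = Max E + 1"
  have "finite E" using finite_dom by (auto simp: E_def)
  then have less: "e < t" if "e \<in> E" for e using Max_ge[OF _ that] by (simp add: t_def)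
  have t: "0 \<le> t" using less[of 0] by (simp add: E_def)
  have w_wait: "waiting t w"
    using None w less[of "a w"] by (auto simp: waiting_def E_def)
  have started: "b < t \<and> b + f i < t" if "\<sigma> i = Some (m, b)" for i m b
  proof -
    have "i \<in> dom \<sigma>" "snd (the (\<sigma> i)) = b" using that by auto
    then have "b \<in> E" "b + f i \<in> E" unfolding E_def by blast+
    then show ?thesis using less by blast
  qed
  have "w \<notin> slow_starts t (revealed T t) (started_before \<sigma> t)"
  proof
    assume "w \<in> slow_starts t (revealed T t) (started_before \<sigma> t)"
    then obtain k where "started_at \<sigma> t w = Some (Slow k)" by (rule H_slow_starts[OF decision[OF t]])
    then show False using None by (simp add: started_at_iff)
  qed
  then have "\<phi> * C t < s w + t" using w_wait by (simp add: slow_starts_iff)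
  then obtain m where "waiting t m" "\<phi> * t < f m"
  proof (rule blocked[OF t w_wait])
    show "b + f i \<le> t" if "\<sigma> i = Some (Fast, b)" for i b using started[OF that] by simp
    show "\<sigma> i \<noteq> Some (Fast, t)" for i using started by blast
  qed
  moreover from this have "f m / \<phi> < t" by (intro less) (unfold E_def waiting_def, blast)
  ultimately show False using phi_pos by (simp add: field_simps)
qed

lemma valid: "valid_schedule T \<sigma>"
  unfolding valid_schedule_def
proof (intro conjI allI impI)
  show "dom \<sigma> = {..<length T}"
    using all_started started_waiting by (force simp: waiting_def)
  show "a i \<le> b" if "\<sigma> i = Some (m, b)" for i m b
    using started_waiting[OF that] by (simp add: waiting_def)
  show "b + run_time m (T ! i) \<le> c \<or> c + run_time m (T ! j) \<le> b"
    if "i \<noteq> j" "\<sigma> i = Some (m, b)" "\<sigma> j = Some (m, c)" for i j m b c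
  proof (cases m)
    case Fast
    then show ?thesis
      using that fast_start(3)[of i b j c] fast_start(3)[of j c i b] fast_start(4)[of i b j]
      by (cases b c rule: linorder_cases) auto
  next
    case (Slow k)
    then show ?thesis using that slow_machine_unique by blast
  qed
qed

section \<open>Busy periods in a produced schedule\<close>

definition start :: "nat \<Rightarrow> real" where
  "start i = snd (the (\<sigma> i))"

definition fast_tasks :: "nat set" where
  "fast_tasks = {i. \<sigma> i = Some (Fast, start i)}"

lemma fast_tasks_iff: "\<sigma> i = Some (Fast, b) \<longleftrightarrow> i \<in> fast_tasks \<and> b = start i"
  by (auto simp: fast_tasks_def start_def)

lemma fast_task:
  assumes "i \<in> fast_tasks"
  shows "i < length T" "0 < f i" "a i \<le> start i" "0 \<le> start i"
  using fast_start(1)[of i "start i"] assms start_nonneg[of i] task_pos[of i]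
  by (auto simp: fast_tasks_iff waiting_def)

lemma finite_fast_tasks: "finite fast_tasks"
  by (rule finite_subset[of _ "{..<length T}"]) (auto simp: fast_task)

lemma fast_tasks_disjoint:
  "i \<in> fast_tasks \<Longrightarrow> j \<in> fast_tasks \<Longrightarrow> start i < start j \<Longrightarrow> start i + f i \<le> start j"
  using fast_start(3)[of j "start j" i "start i"] by (simp add: fast_tasks_iff)

lemma inj_on_start: "inj_on start fast_tasks"
  using fast_start(4) by (intro inj_onI) (auto simp: fast_tasks_iff)

lemma sum_between_le:
  assumes "x \<in> fast_tasks" "u \<le> start x"
  shows "u + sum f {z\<in>fast_tasks. u \<le> start z \<and> start z < start x} \<le> start x"
proof (rule sum_disjoint_intervals_le[where b = start])
  show "start y + f y \<le> start z \<or> start z + f z \<le> start y"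
    if "y \<in> {z\<in>fast_tasks. u \<le> start z \<and> start z < start x}"
      "z \<in> {z\<in>fast_tasks. u \<le> start z \<and> start z < start x}" "y \<noteq> z" for y z
    using that fast_tasks_disjoint[of y z] fast_tasks_disjoint[of z y] inj_on_start
    by (cases "start y" "start z" rule: linorder_cases) (auto simp: inj_on_def)
qed (use assms finite_fast_tasks fast_tasks_disjoint fast_task in auto)

text \<open>The busy period containing \<open>x\<close> is traced back to its beginning
  \<open>p\<close> and shown to be an instance of \<open>busy_chain\<close>.\<close>

lemma fast_completion:
  assumes x: "x \<in> fast_tasks"
  shows "start x + f x \<le> \<phi> * opt T"
proof -
  \<comment> \<open>These are the tasks from whose start the fast machine is busy without a gap
    until \<open>x\<close> starts; the earliest of them opens the busy period.\<close>
  define D where "D = {y\<in>fast_tasks. start y \<le> start x \<and>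
    start y + sum f {z\<in>fast_tasks. start y \<le> start z \<and> start z < start x} = start x}"
  have "sum f {z\<in>fast_tasks. start x \<le> start z \<and> start z < start x} = 0"
    by (rule sum.neutral) auto
  then have "x \<in> D" using x unfolding D_def by simp
  have "finite D" using finite_fast_tasks by (simp add: D_def)
  then obtain y where y: "y \<in> D" and y_min: "\<And>z. z \<in> D \<Longrightarrow> start y \<le> start z"
    using \<open>x \<in> D\<close> arg_min_if_finite(1)[of D start] arg_min_least[of D _ start] by blast
  define p where "p = start y"
  define W where "W = {z\<in>fast_tasks. p \<le> start z \<and> start z \<le> start x}"
  have yW: "y \<in> fast_tasks" "p \<le> start x" "0 \<le> p"
    "p + sum f {z\<in>fast_tasks. p \<le> start z \<and> start z < start x} = start x"
    using y fast_task(4)[of y] by (auto simp: p_def D_def)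
  \<comment> \<open>A task ending exactly at \<open>p\<close> would belong to \<open>D\<close> and
    start before \<open>y\<close>.\<close>
  have gap: "start z + f z < p" if z: "z \<in> fast_tasks" "start z < p" for z
  proof (rule ccontr)
    assume "\<not> ?thesis"
    then have eq: "start z + f z = p"
      using fast_tasks_disjoint[of z y] z yW by (simp add: p_def)
    have "{i\<in>fast_tasks. start z \<le> start i \<and> start i < start x}
        = insert z {i\<in>fast_tasks. p \<le> start i \<and> start i < start x}"
    proof (intro equalityI subsetI)
      fix i assume i: "i \<in> {i\<in>fast_tasks. start z \<le> start i \<and> start i < start x}"
      show "i \<in> insert z {i\<in>fast_tasks. p \<le> start i \<and> start i < start x}"
      proof (cases "i = z")
        case False
        then have "start z < start i" using i z inj_on_start by (auto simp: inj_on_def order_le_less)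
        then show ?thesis using i z fast_tasks_disjoint[of z i] eq by auto
      qed simp
    next
      fix i assume i: "i \<in> insert z {i\<in>fast_tasks. p \<le> start i \<and> start i < start x}"
      then show "i \<in> {i\<in>fast_tasks. start z \<le> start i \<and> start i < start x}"
        using z yW by auto
    qed
    moreover have "z \<notin> {i\<in>fast_tasks. p \<le> start i \<and> start i < start x}" using z by auto
    ultimately have "z \<in> D"
      using z yW eq finite_fast_tasks by (simp add: D_def)
    then show False using y_min[of z] z by (simp add: p_def)
  qed
  have idle: "(\<forall>w\<in>W. p \<le> a w) \<or> (\<exists>m\<in>{..<length T}. a m < p \<and> \<phi> * p \<le> f m \<and>
      (\<forall>w\<in>W. a w < p \<longrightarrow> s w + a w \<le> s m + a m))"
  proof (rule disjCI)
    assume neg: "\<not> (\<exists>m\<in>{..<length T}. a m < p \<and> \<phi> * p \<le> f m \<and>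
      (\<forall>w\<in>W. a w < p \<longrightarrow> s w + a w \<le> s m + a m))"
    show "\<forall>w\<in>W. p \<le> a w"
    proof (rule ccontr)
      assume "\<not> ?thesis"
      then obtain w where w: "w \<in> W" "a w < p" by auto
      have w': "w \<in> fast_tasks" "p \<le> start w" using w by (auto simp: W_def)
      \<comment> \<open>Between the last of these events before \<open>p\<close> and
        \<open>p\<close> itself nothing changes for the fast machine. A time \<open>t\<close> chosen
        there finds it free although \<open>w\<close> is waiting, so \<open>blocked\<close> supplies
        \<open>m\<close>.\<close>
      define E where "E = {e. e < p} \<inter> ({0} \<union> a ` {..<length T} \<union> (\<lambda>i. f i / \<phi>) ` {..<length T}
        \<union> start ` fast_tasks \<union> (\<lambda>i. start i + f i) ` fast_tasks)"
      have "0 < p" using w w' fast_task(1)[of w] task_pos(2)[of w] by simp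
      then have "finite E" "0 \<in> E" using finite_fast_tasks by (auto simp: E_def)
      then have "Max E < p" using Max_in[of E] by (auto simp: E_def)
      then obtain t where t: "Max E < t" "t < p" using dense by blast
      have before: "e < t" if "e \<in> E" for e using Max_ge[OF \<open>finite E\<close> that] t by simp
      have t0: "0 \<le> t" using before[OF \<open>0 \<in> E\<close>] by simp
      have W_wait: "waiting t i" "\<phi> * C t < s i + t" if i: "i \<in> W" "a i < p" for i
      proof -
        have i': "i \<in> fast_tasks" "p \<le> start i" using i by (auto simp: W_def)
        have "a i \<in> E" using i fast_task(1)[OF i'(1)] unfolding E_def by blast
        then have "a i \<le> t" using before[of "a i"] by simp
        then show "waiting t i" "\<phi> * C t < s i + t"
          using fast_waits[of i "start i" t] i' t by (auto simp: fast_tasks_iff)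
      qed
      obtain m where m: "waiting t m" "\<phi> * t < f m"
        "\<And>j. waiting t j \<Longrightarrow> \<phi> * C t < s j + t \<Longrightarrow> s j + a j \<le> s m + a m"
      proof (rule blocked[OF t0 W_wait[OF w]])
        show "b + f i \<le> t" if "\<sigma> i = Some (Fast, b)" "b < t" for i b
        proof -
          have i: "i \<in> fast_tasks" "b = start i" using that by (auto simp: fast_tasks_iff)
          then have "start i + f i < p" using gap that t by simp
          then have "start i + f i \<in> E" using i unfolding E_def by blast
          then show ?thesis using before i by force
        qed
        show "\<sigma> i \<noteq> Some (Fast, t)" for i
        proof
          assume "\<sigma> i = Some (Fast, t)"
          then have i: "i \<in> fast_tasks" "t = start i" by (auto simp: fast_tasks_iff)
          then have "t \<in> E" using t unfolding E_def by blast
          then show False using before by blast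
        qed
      qed blast
      have "m < length T" "a m < p" using m(1) t by (auto simp: waiting_def)
      moreover have "\<phi> * p \<le> f m"
      proof (rule ccontr)
        assume "\<not> ?thesis"
        \<comment> \<open>The bound for \<open>m\<close> at \<open>t\<close> extends to
          \<open>p\<close>, since the ripening time \<open>f m / \<phi>\<close> would otherwise be
          one of the events in \<open>E\<close>.\<close>
        then have "f m / \<phi> < p" using phi_pos by (simp add: field_simps)
        then have "f m / \<phi> \<in> E" using \<open>m < length T\<close> unfolding E_def by blast
        then have "f m / \<phi> < t" by (rule before)
        then show False using m(2) phi_pos by (simp add: field_simps)
      qed
      ultimately show False using neg m(3) W_wait by blast
    qed
  qed
  have rev: "i < length T \<Longrightarrow> a i \<le> t \<Longrightarrow> i < length (revealed T t) \<and> revealed T t ! i = T ! i" for i t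
    using less_length_revealed_iff[OF TAP] nth_revealed[OF TAP] by blast
  interpret busy_chain "{..<length T}" W f s a start C p
  proof
    fix i t assume i: "i \<in> {..<length T}" "a i \<le> t"
    then show "a i + f i \<le> C t"
      using opt_ge_task[OF TAP_revealed[OF TAP], of i t] rev[of i t] by simp
    define A where "A = {i\<in>{..<length T}. a i \<le> t}"
    have "finite A" "A \<noteq> {}" using i by (auto simp: A_def)
    \<comment> \<open>Nothing arrives between the latest arrival up to \<open>t\<close> and
      \<open>t\<close>, so the revealed lists agree.\<close>
    then obtain j where j: "j \<in> A" and j_max: "\<And>i. i \<in> A \<Longrightarrow> - a j \<le> - a i"
      using arg_min_if_finite(1)[of A "\<lambda>i. - a i"] arg_min_least[of A _ "\<lambda>i. - a i"] by blast
    have "revealed T (a j) = revealed T t"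
      unfolding revealed_def
    proof (rule filter_cong[OF refl])
      fix \<tau> assume "\<tau> \<in> set T"
      then obtain l where "l < length T" "\<tau> = T ! l" by (auto simp: in_set_conv_nth)
      then show "arrival \<tau> \<le> a j \<longleftrightarrow> arrival \<tau> \<le> t"
        using j j_max[of l] by (auto simp: A_def)
    qed
    then show "\<exists>j\<in>{..<length T}. a j \<le> t \<and> C (a j) = C t"
      using j by (auto simp: A_def)
  next
    fix Y r t
    assume Y: "Y \<subseteq> {..<length T}" "r \<le> C t"
      "\<And>y. y \<in> Y \<Longrightarrow> r \<le> a y \<and> a y \<le> t \<and> C t < s y + a y"
    have "r + (\<Sum>y\<in>Y. fast_time (revealed T t ! y)) \<le> C t"
    proof (rule opt_pack[OF TAP_revealed[OF TAP]])
      show "Y \<subseteq> {..<length (revealed T t)}" using Y rev by auto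
    qed (use Y rev in auto)
    moreover have "(\<Sum>y\<in>Y. fast_time (revealed T t ! y)) = sum f Y"
      using Y rev by (intro sum.cong) auto
    ultimately show "r + sum f Y \<le> C t" by simp
  next
    fix z assume z: "z \<in> W"
    then have zW: "z \<in> fast_tasks" "p \<le> start z" "start z \<le> start x" by (auto simp: W_def)
    \<comment> \<open>Cut at \<open>start z\<close>: the work on each side is at most the length of
      that side, and together they fill the time from \<open>p\<close> to \<open>start x\<close>, so
      both bounds are equalities.\<close>
    have "{i\<in>fast_tasks. p \<le> start i \<and> start i < start x}
        = {i\<in>fast_tasks. p \<le> start i \<and> start i < start z}
          \<union> {i\<in>fast_tasks. start z \<le> start i \<and> start i < start x}" using zW by auto
    moreover have "sum f \<dots> = sum f {i\<in>fast_tasks. p \<le> start i \<and> start i < start z}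
        + sum f {i\<in>fast_tasks. start z \<le> start i \<and> start i < start x}"
      using finite_fast_tasks by (intro sum.union_disjoint) auto
    moreover have "{y\<in>W. start y < start z} = {i\<in>fast_tasks. p \<le> start i \<and> start i < start z}"
      using zW by (auto simp: W_def)
    ultimately show "start z = p + sum f {y\<in>W. start y < start z}"
      using sum_between_le[OF zW(1,2)] sum_between_le[OF x zW(3)] yW(4) by simp
  next
    fix w z assume wz: "w \<in> W" "z \<in> W" "start w < start z" "a z \<le> start w"
    then have "\<sigma> w = Some (Fast, start w)" "\<sigma> z = Some (Fast, start z)" by (auto simp: W_def fast_tasks_iff)
    then show "s z + a z \<le> s w + a w"
      using fast_start(5)[of w "start w" z] fast_waits[of z "start z" "start w"] wz by simp
  next
    show "inj_on start W" by (rule inj_on_subset[OF inj_on_start]) (auto simp: W_def)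
  next
    fix w assume "w \<in> W"
    then have w: "w \<in> fast_tasks" "\<sigma> w = Some (Fast, start w)" by (auto simp: W_def fast_tasks_iff)
    show "a w \<le> start w" "f w \<le> \<phi> * start w" using fast_task(3) fast_start(2) w by auto
    show "\<phi> * C u < s w + u" if "a w \<le> u" "u \<le> start w" for u using fast_waits(2)[OF w(2) that] .
  qed (use yW idle task_pos fast_task(1) opt_revealed_mono[OF TAP] in \<open>auto simp: W_def\<close>)
  have le_opt: "a i \<le> opt T" if "i < length T" for i
    using opt_ge_task[OF TAP that] task_pos[OF that] by simp
  \<comment> \<open>Hence \<open>opt T\<close> is a time equal to the optimum revealed at it, as
    \<open>completion_bound\<close> demands.\<close>
  have "revealed T (opt T) = T"
    using le_opt by (auto simp: revealed_def filter_id_conv in_set_conv_nth)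
  then show ?thesis
    using completion_bound[of x "opt T"] le_opt x yW by (simp add: W_def)
qed

lemma completion: "completion_time T \<sigma> \<le> \<phi> * opt T"
proof (rule completion_time_le)
  show "0 \<le> \<phi> * opt T" using phi_pos opt_nonneg by simp
  fix i m b assume i: "i < length T" "\<sigma> i = Some (m, b)"
  show "b + run_time m (T ! i) \<le> \<phi> * opt T"
  proof (cases m)
    case Fast
    then show ?thesis using fast_completion[of i] i by (simp add: fast_tasks_iff)
  next
    case (Slow k)
    have "\<phi> * C b \<le> \<phi> * opt T" using opt_revealed_le[OF TAP] phi_pos by simp
    then show ?thesis using slow_start(2)[of i k b] i Slow by simp
  qed
qed

end

section \<open>Existence of a run\<close>

lemma H_nonempty:
  assumes "finite (dom h)"
  shows "H t R h \<noteq> {}"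
proof -
  define used where "used = {k. \<exists>j b. h j = Some (Slow k, b)}"
  have "used \<subseteq> (\<lambda>j. case the (h j) of (Slow k, b) \<Rightarrow> k | _ \<Rightarrow> 0) ` dom h"
    by (force simp: used_def image_iff)
  then have "finite used" using assms finite_surj by blast
  then obtain n where n: "\<And>k. k \<in> used \<Longrightarrow> k < n"
    by (meson finite_nat_set_iff_bounded)
  define F where "F = (if fast_candidates t R h = {} then {} else {SOME i. i \<in> fast_candidates t R h})"
  have F: "if fast_candidates t R h = {} then F = {} else \<exists>i\<in>fast_candidates t R h. F = {i}"
    by (auto simp: F_def some_in_eq)
  then have disj: "i \<notin> slow_starts t R h" if "i \<in> F" for i
    using that fast_candidates_disjoint[of t R h] by (auto split: if_splits)
  define d where "d i = (if i \<in> slow_starts t R h then Some (Slow (n + i))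
    else if i \<in> F then Some Fast else None)" for i
  have "n + i \<notin> used" for i using n[of "n + i"] by auto
  then have "d \<in> H t R h"
    unfolding H_def using F disj
    by (intro CollectI exI[of _ F]) (auto simp: d_def used_def split: if_splits)
  then show ?thesis by blast
qed

text \<open>The history is \<open>\<sigma>\<close> itself, without truncation at \<open>t\<close>.
  If it already contains the starts made at \<open>t\<close>, the predicate says that nothing
  further is due at that time.\<close>

definition idle :: "task list \<Rightarrow> schedule \<Rightarrow> real \<Rightarrow> bool" where
  "idle T \<sigma> t \<longleftrightarrow>
     slow_starts t (revealed T t) \<sigma> = {} \<and> fast_candidates t (revealed T t) \<sigma> = {}"

lemma finite_no_points_right:
  fixes t :: real
  assumes "finite E"
  obtains \<delta> where "0 < \<delta>" "\<And>x. x \<in> E \<Longrightarrow> x < t + \<delta> \<Longrightarrow> x \<le> t"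
proof (cases "{x\<in>E. t < x} = {}")
  case True
  then show ?thesis using that[of 1] by force
next
  case False
  define y where "y = Min {x\<in>E. t < x}"
  have "y \<in> {x\<in>E. t < x}" unfolding y_def using False assms by (intro Min_in) auto
  moreover have "y \<le> x" if "x \<in> E" "t < x" for x
    unfolding y_def using that assms by (intro Min_le) auto
  ultimately show ?thesis using that[of "y - t"] by force
qed

text \<open>The next time at which H acts is an infimum. It is attained because idleness, once it holds,
  persists for a while.\<close>

lemma idle_right:
  assumes "finite (dom \<sigma>)" "idle T \<sigma> t"
  obtains \<delta> where "0 < \<delta>" "\<And>u. t \<le> u \<Longrightarrow> u < t + \<delta> \<Longrightarrow> idle T \<sigma> u"
proof -
  define R where "R = revealed T t"
  \<comment> \<open>The times at which the revealed list can grow, the fast machine can become free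
    or a task can ripen.\<close>
  define E where "E = arrival ` set T \<union> (\<lambda>i. snd (the (\<sigma> i)) + fast_time (R ! i)) ` dom \<sigma>
    \<union> (\<lambda>i. fast_time (R ! i) / \<phi>) ` {..<length R}"
  have "finite E" using assms by (simp add: E_def)
  then obtain \<delta> where \<delta>: "0 < \<delta>" "\<And>x. x \<in> E \<Longrightarrow> x < t + \<delta> \<Longrightarrow> x \<le> t"
    using finite_no_points_right by blast
  have "idle T \<sigma> u" if u: "t \<le> u" "u < t + \<delta>" for u
  proof -
    have no: "x \<le> t" if "x \<in> E" "x \<le> u" for x using \<delta>(2)[OF that(1)] that(2) u by simp
    have R: "revealed T u = R"
      unfolding R_def revealed_def
    proof (rule filter_cong[OF refl])
      fix \<tau> assume "\<tau> \<in> set T"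
      then have "arrival \<tau> \<in> E" by (simp add: E_def)
      then show "arrival \<tau> \<le> u \<longleftrightarrow> arrival \<tau> \<le> t" using no u by force
    qed
    have slow: "slow_starts t R \<sigma> = {}" "fast_candidates t R \<sigma> = {}"
      using assms(2) by (auto simp: idle_def R_def)
    \<comment> \<open>With the optimum unchanged, the slow rule only becomes harder to satisfy as
      time passes.\<close>
    then have slow_u: "slow_starts u R \<sigma> = {}" using u by (force simp: slow_starts_def)
    have "i \<in> fast_candidates t R \<sigma>" if i: "i \<in> fast_candidates u R \<sigma>" for i
    proof -
      note * = fast_candidatesD[OF i]
      have "fast_free t R \<sigma>"
        unfolding fast_free_def
      proof (intro allI impI)
        fix j b assume j: "\<sigma> j = Some (Fast, b)"
        then have "j \<in> dom \<sigma>" "snd (the (\<sigma> j)) = b" by auto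
        then have "b + fast_time (R ! j) \<in> E" unfolding E_def by blast
        then show "b + fast_time (R ! j) \<le> t" using no *(3) j by (auto simp: fast_free_def)
      qed
      moreover have "fast_time (R ! i) / \<phi> \<in> E" using *(1) by (auto simp: E_def standby_def)
      then have "fast_time (R ! i) / \<phi> \<le> t" using no *(4) by simp
      ultimately show ?thesis
        using * slow slow_u by (simp add: fast_candidates_def Let_def)
    qed
    then show ?thesis using slow slow_u R by (auto simp: idle_def)
  qed
  then show ?thesis using that \<delta>(1) by blast
qed

lemma next_action:
  assumes fin: "finite (dom \<sigma>)" and e: "e < 0 \<or> idle T \<sigma> e"
    and u: "e < u" "0 \<le> u" "\<not> idle T \<sigma> u"
  obtains t where "e < t" "0 \<le> t" "\<not> idle T \<sigma> t" "\<And>v. e < v \<Longrightarrow> 0 \<le> v \<Longrightarrow> v < t \<Longrightarrow> idle T \<sigma> v"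
proof -
  define A where "A = {v. e < v \<and> 0 \<le> v \<and> \<not> idle T \<sigma> v}"
  have ne: "A \<noteq> {}" using u by (auto simp: A_def)
  have bdd: "bdd_below A" by (rule bdd_belowI[of _ 0]) (simp add: A_def)
  define t where "t = Inf A"
  have t: "0 \<le> t" "e \<le> t" unfolding t_def by (rule cInf_greatest[OF ne]; simp add: A_def)+
  have "t \<in> A"
  proof (rule ccontr)
    assume "t \<notin> A"
    then have "idle T \<sigma> t" using t e by (cases "t = e") (auto simp: A_def)
    then obtain \<delta> where \<delta>: "0 < \<delta>" "\<And>u. t \<le> u \<Longrightarrow> u < t + \<delta> \<Longrightarrow> idle T \<sigma> u"
      using idle_right[OF fin] by blast
    have "t + \<delta> \<le> v" if "v \<in> A" for v
      using \<delta>(2)[of v] cInf_lower[OF that bdd] that by (force simp: t_def A_def)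
    then have "t + \<delta> \<le> t" unfolding t_def by (intro cInf_greatest[OF ne])
    then show False using \<delta>(1) by simp
  qed
  moreover have "idle T \<sigma> v" if "e < v" "0 \<le> v" "v < t" for v
    using cInf_lower[OF _ bdd, of v] that by (force simp: t_def A_def)
  ultimately show ?thesis using that by (auto simp: A_def)
qed

text \<open>A run that is correct up to and including time \<open>e\<close>. Idleness at
  \<open>e\<close> records that the action at \<open>e\<close> is complete; a negative
  \<open>e\<close> stands for a run that has not begun.\<close>

definition partial_run :: "task list \<Rightarrow> schedule \<Rightarrow> real \<Rightarrow> bool" where
  "partial_run T \<sigma> e \<longleftrightarrow> dom \<sigma> \<subseteq> {..<length T} \<and>
     (\<forall>i m b. \<sigma> i = Some (m, b) \<longrightarrow> 0 \<le> b \<and> b \<le> e) \<and>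
     (\<forall>t. 0 \<le> t \<longrightarrow> t \<le> e \<longrightarrow> started_at \<sigma> t \<in> H t (revealed T t) (started_before \<sigma> t)) \<and>
     (e < 0 \<or> idle T \<sigma> e)"

lemma started_after:
  assumes "partial_run T \<sigma> e" "e < t"
  shows "started_before \<sigma> t = \<sigma>" "started_at \<sigma> t = Map.empty"
  using assms by (fastforce simp: partial_run_def started_before_def started_at_def fun_eq_iff
      split: option.splits)+

lemma idle_empty_H: "idle T \<sigma> t \<Longrightarrow> Map.empty \<in> H t (revealed T t) \<sigma>"
  by (simp add: idle_def H_def)

text \<open>After acting at \<open>t\<close>, H is idle there: all slow starts are made, and a fast
  start occupies the fast machine because fast times are positive. Without a fast start there was no
  candidate, and the slow starts create none, as candidates are chosen after their removal.\<close>

lemma partial_run_step: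
  assumes T: "TAP T" and run: "partial_run T \<sigma> e" and "e < t" "0 \<le> t" and "\<not> idle T \<sigma> t"
    and between: "\<And>v. e < v \<Longrightarrow> 0 \<le> v \<Longrightarrow> v < t \<Longrightarrow> idle T \<sigma> v"
  obtains \<sigma>' where "partial_run T \<sigma>' t" "dom \<sigma> \<subset> dom \<sigma>'"
proof -
  let ?R = "revealed T t"
  have dom: "dom \<sigma> \<subseteq> {..<length T}" and starts: "\<And>i m b. \<sigma> i = Some (m, b) \<Longrightarrow> 0 \<le> b \<and> b \<le> e"
    using run by (auto simp: partial_run_def)
  have "finite (dom \<sigma>)" using dom finite_subset by blast
  then obtain d where d: "d \<in> H t ?R \<sigma>" using H_nonempty by blast
  obtain F where F: "if fast_candidates t ?R \<sigma> = {} then F = {} else \<exists>i\<in>fast_candidates t ?R \<sigma>. F = {i}"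
    "dom d = slow_starts t ?R \<sigma> \<union> F" "\<forall>i\<in>F. d i = Some Fast"
    using d unfolding H_def by blast
  have d_standby: "dom d \<subseteq> standby ?R \<sigma>"
    using F fast_candidatesD(1) by (auto simp: slow_starts_def split: if_splits)
  define \<sigma>' where "\<sigma>' = \<sigma> ++ (\<lambda>i. map_option (\<lambda>m. (m, t)) (d i))"
  have \<sigma>'_iff: "\<sigma>' i = Some (m, b) \<longleftrightarrow> \<sigma> i = Some (m, b) \<or> (d i = Some m \<and> b = t)" for i m b
    using d_standby by (force simp: \<sigma>'_def map_add_def standby_def split: option.splits)
  have dom': "dom \<sigma>' = dom \<sigma> \<union> dom d"
    by (auto simp: \<sigma>'_def map_add_def split: option.splits)
  have \<sigma>'_eq: "\<sigma>' i = (case d i of None \<Rightarrow> \<sigma> i | Some m \<Rightarrow> Some (m, t))" for i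
    by (simp add: \<sigma>'_def map_add_def split: option.split)
  have fresh: "\<sigma> i = None" if "d i = Some m" for i m
    using that d_standby by (auto simp: standby_def)
  have before: "started_before \<sigma>' v = started_before \<sigma> v" if "v \<le> t" for v
    using that fresh by (intro ext) (auto simp: started_before_def \<sigma>'_eq split: option.split)
  have at: "started_at \<sigma>' v = started_at \<sigma> v" if "v < t" for v
    using that fresh by (intro ext) (auto simp: started_at_def \<sigma>'_eq split: option.split)
  have at_t: "started_at \<sigma>' t = d"
    using starts \<open>e < t\<close> by (intro ext) (force simp: started_at_def \<sigma>'_eq split: option.split)
  have "started_at \<sigma>' v \<in> H v (revealed T v) (started_before \<sigma>' v)" if v: "0 \<le> v" "v \<le> t" for v
  proof -
    consider "v = t" | "v < t" "e < v" | "v \<le> e" using v by linarith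
    then show ?thesis
    proof cases
      case 1
      then show ?thesis using d at_t before[of t] started_after(1)[OF run \<open>e < t\<close>] by simp
    next
      case 2
      then show ?thesis
        using idle_empty_H between[OF 2(2) v(1) 2(1)] at before[of v] started_after[OF run 2(2)] by simp
    next
      case 3
      then show ?thesis using run v at[of v] before[of v] \<open>e < t\<close> by (simp add: partial_run_def)
    qed
  qed
  moreover have "idle T \<sigma>' t"
  proof -
    have standby': "standby ?R \<sigma>' = standby ?R \<sigma> - dom d"
      using dom' by (auto simp: standby_def)
    have slow': "slow_starts t ?R \<sigma>' = {}"
      using standby' F(2) by (auto simp: slow_starts_def)
    have "fast_candidates t ?R \<sigma>' = {}"
    proof (cases "F = {}")
      case True
      then have "fast_candidates t ?R \<sigma> = {}" using F(1) by (auto split: if_splits)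
      moreover have "standby ?R \<sigma>' = standby ?R \<sigma> - slow_starts t ?R \<sigma>"
        using standby' F(2) True by simp
      moreover have "fast_free t ?R \<sigma>" if "fast_free t ?R \<sigma>'"
        using that \<sigma>'_iff by (auto simp: fast_free_def)
      ultimately show ?thesis
        using slow' by (auto simp: fast_candidates_def Let_def)
    next
      case False
      then obtain i where i: "i \<in> F" "i \<in> fast_candidates t ?R \<sigma>"
        using F(1) by (auto split: if_splits)
      have "i < length ?R" using fast_candidatesD(1)[OF i(2)] by (simp add: standby_def)
      then have "0 < fast_time (?R ! i)"
        using valid_task_nth[OF TAP_revealed[OF T]] by (simp add: valid_task_def)
      moreover have "\<sigma>' i = Some (Fast, t)" using \<sigma>'_iff i F(3) by simp
      ultimately have "\<not> fast_free t ?R \<sigma>'" by (force simp: fast_free_def)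
      then show ?thesis by (simp add: fast_candidates_def Let_def)
    qed
    then show ?thesis using slow' by (simp add: idle_def)
  qed
  moreover have "dom \<sigma>' \<subseteq> {..<length T}"
    using dom dom' d_standby less_length_revealed_iff[OF T] by (auto simp: standby_def)
  ultimately have "partial_run T \<sigma>' t"
    using starts \<sigma>'_iff assms(3,4) by (force simp: partial_run_def)
  moreover have "dom d \<noteq> {}"
    using \<open>\<not> idle T \<sigma> t\<close> F by (auto simp: idle_def split: if_splits)
  then have "dom \<sigma> \<subset> dom \<sigma>'" using dom' d_standby by (auto simp: standby_def)
  ultimately show ?thesis by (rule that)
qed

text \<open>Each action starts a new task, so after at most \<open>length T\<close> actions H stays
  idle forever and the partial run is a full one.\<close>

lemma partial_run_extends:
  assumes T: "TAP T" and "partial_run T \<sigma> e"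
  shows "\<exists>\<sigma>'. produces H T \<sigma>'"
  using assms(2)
proof (induction "length T - card (dom \<sigma>)" arbitrary: \<sigma> e rule: less_induct)
  case less
  have dom: "dom \<sigma> \<subseteq> {..<length T}" using less.prems by (simp add: partial_run_def)
  then have fin: "finite (dom \<sigma>)" using finite_subset by blast
  show ?case
  proof (cases "\<exists>u. e < u \<and> 0 \<le> u \<and> \<not> idle T \<sigma> u")
    case True
    moreover have "e < 0 \<or> idle T \<sigma> e" using less.prems by (simp add: partial_run_def)
    ultimately obtain t where "e < t" "0 \<le> t" "\<not> idle T \<sigma> t"
      "\<And>v. e < v \<Longrightarrow> 0 \<le> v \<Longrightarrow> v < t \<Longrightarrow> idle T \<sigma> v"
      using next_action[OF fin] by metis
    then obtain \<sigma>' where \<sigma>': "partial_run T \<sigma>' t" "dom \<sigma> \<subset> dom \<sigma>'"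
      using partial_run_step[OF T less.prems] by blast
    have dom': "dom \<sigma>' \<subseteq> {..<length T}" using \<sigma>' by (simp add: partial_run_def)
    then have "card (dom \<sigma>) < card (dom \<sigma>')"
      using \<sigma>'(2) finite_subset by (intro psubset_card_mono) auto
    moreover have "card (dom \<sigma>') \<le> length T" using card_mono[OF _ dom'] by simp
    ultimately show ?thesis using less.hyps[OF _ \<sigma>'(1)] by simp
  next
    case False
    have "started_at \<sigma> t \<in> H t (revealed T t) (started_before \<sigma> t)" if t: "0 \<le> t" for t
    proof (cases "t \<le> e")
      case True
      then show ?thesis using less.prems t by (simp add: partial_run_def)
    next
      case late: False
      then show ?thesis
        using False t idle_empty_H[of T \<sigma> t] started_after[OF less.prems, of t] by simp
    qed
    then have "produces H T \<sigma>" using less.prems by (auto simp: produces_def partial_run_def)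
    then show ?thesis by blast
  qed
qed

text \<open>Time -1 precedes every decision, so the empty schedule is a partial run up to
  it.\<close>

lemma run_exists:
  assumes "TAP T" shows "\<exists>\<sigma>. produces H T \<sigma>"
  by (rule partial_run_extends[OF assms, of Map.empty "-1"]) (simp add: partial_run_def)

theorem theorem1:
  shows "eventually_committing_scheduler H \<and> competitive \<phi> H"
proof -
  have "valid_schedule T \<sigma>" "completion_time T \<sigma> \<le> \<phi> * opt T" if "TAP T" "produces H T \<sigma>" for T \<sigma>
  proof -
    interpret H_run T \<sigma> using that by unfold_locales
    show "valid_schedule T \<sigma>" "completion_time T \<sigma> \<le> \<phi> * opt T" by (rule valid, rule completion)
  qed
  then show ?thesis
    using run_exists by (auto simp: eventually_committing_scheduler_def competitive_def)
qed

end
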